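(* (1) For each $\epsilon>0$ there exists an infinite iterated function system (IIFS) $\mathcal{F}$ of similarities on the unit square $[0,1]^2$ satisfying the open set condition such that $\operatorname{s-dim}(\mathcal{F})<1+\epsilon$ and the attractor of $\mathcal{F}$ is a continuum but is not path connected. (2) For each $\epsilon>0$ there exists an IIFS $\mathcal{F}$ of similarities on the unit square $[0,1]^2$ satisfying the open set condition such that $\operatorname{s-dim}(\mathcal{F})<1+\epsilon$ and the attractor of $\mathcal{F}$ is the image of a curve, but is not the image of a H\"older curve.
   Context: An infinite iterated function system (IIFS) on a compact metric space $X$ is a countably infinite collection $\mathcal{F}=\{\phi_i : i\in\mathbb{N}\}$ of contractions $\phi_i:X\to X$. Here $\operatorname{Lip}(\phi)$ is the infimum of all $L>0$ for which $\phi$ is $L$-Lipschitz, and it is always assumed that $\operatorname{Lip}(\phi)\in(0,1)$ for every $\phi\in\mathcal{F}$. The attractor of $\mathcal{F}$ is $$K=\bigcup_{(i_n)\subset\mathbb{N}}\ \bigcap_{n=1}^{\infty}\phi_{i_1}\circ\cdots\circ\phi_{i_n}(X),$$ where the union is over all infinite sequences $(i_n)_{n\ge 1}$ in $\mathbb{N}$. The similarity dimension is $\operatorname{s-dim}(\mathcal{F})=\inf\{t\ge 0:\psi_{\mathcal{F}}(t)\le 1\}$, where $\psi_{\mathcal{F}}(t)=\sum_{\phi\in\mathcal{F}}\operatorname{Lip}(\phi)^t$. A similarity in $\mathbb{R}^n$ is the composition of a dilation and an isometry; an IIFS of similarities on $[0,1]^2$ consists of (restrictions of) similarities of $\mathbb{R}^2$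 mapping $[0,1]^2$ (Euclidean metric) into itself. It satisfies the open set condition (OSC) if there is a nonempty open set $U\subset\mathbb{R}^2$ such that $\phi(U)\subset U$ for all $\phi\in\mathcal{F}$ and $\phi(U)\cap\phi'(U)=\emptyset$ for all distinct $\phi,\phi'\in\mathcal{F}$. A continuum is a compact connected set. A set is the image of a curve if it is the image of $[0,1]$ under a continuous map. It is the image of a H\"older curve if, for some $\alpha\ge 1$, it is the image of $[0,1]$ under a $\frac1\alpha$-H\"older continuous map, i.e. a map $f$ for which there is $H>0$ with $d(f(x),f(y))\le H|x-y|^{1/\alpha}$ for all $x,y\in[0,1]$. *)

theory Defs
  imports "HOL-Analysis.Analysis"
begin

text \<open>The set of Lipschitz constants must be nonempty for this infimum to be meaningful;
  in \<open>iifs\<close> below this is guaranteed by \<open>contraction_on\<close>.\<close>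

definition Lip :: "'a::metric_space set \<Rightarrow> ('a \<Rightarrow> 'b::metric_space) \<Rightarrow> real" where
  "Lip X f = Inf {L. L > 0 \<and> L-lipschitz_on X f}"

definition contraction_on :: "'a::metric_space set \<Rightarrow> ('a \<Rightarrow> 'a) \<Rightarrow> bool" where
  "contraction_on X f \<longleftrightarrow> f ` X \<subseteq> X \<and> (\<exists>L<1. L-lipschitz_on X f)"

text \<open>A countably infinite collection of maps is given by an enumeration \<open>\<phi>\<close> without repetitions.
  Only the values on \<open>X\<close> matter, so distinctness is distinctness of the restrictions to \<open>X\<close>.\<close>

definition iifs :: "'a::metric_space set \<Rightarrow> (nat \<Rightarrow> 'a \<Rightarrow> 'a) \<Rightarrow> bool" where
  "iifs X \<phi> \<longleftrightarrow> compact X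
     \<and> (\<forall>i. contraction_on X (\<phi> i) \<and> 0 < Lip X (\<phi> i) \<and> Lip X (\<phi> i) < 1)
     \<and> (\<forall>i j. i \<noteq> j \<longrightarrow> (\<exists>x\<in>X. \<phi> i x \<noteq> \<phi> j x))"

text \<open>\<open>word_map \<phi> s n\<close> is the composition of \<open>\<phi> (s 0)\<close>, ..., \<open>\<phi> (s (n - 1))\<close>, the last one applied
  first; infinite index sequences start at \<open>0\<close>.\<close>

primrec word_map :: "(nat \<Rightarrow> 'a \<Rightarrow> 'a) \<Rightarrow> (nat \<Rightarrow> nat) \<Rightarrow> nat \<Rightarrow> 'a \<Rightarrow> 'a" where
  "word_map \<phi> s 0 = id"
| "word_map \<phi> s (Suc n) = word_map \<phi> s n \<circ> \<phi> (s n)"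

definition attractor :: "'a set \<Rightarrow> (nat \<Rightarrow> 'a \<Rightarrow> 'a) \<Rightarrow> 'a set" where
  "attractor X \<phi> = (\<Union>s. \<Inter>n\<in>{1..}. word_map \<phi> s n ` X)"

text \<open>The sum may be infinite, and there may be no admissible \<open>t\<close>, in which case the similarity
  dimension is \<open>\<infinity>\<close>.\<close>

definition psi :: "'a::metric_space set \<Rightarrow> (nat \<Rightarrow> 'a \<Rightarrow> 'a) \<Rightarrow> real \<Rightarrow> ennreal" where
  "psi X \<phi> t = (\<Sum>i. ennreal (Lip X (\<phi> i) powr t))"

definition s_dim :: "'a::metric_space set \<Rightarrow> (nat \<Rightarrow> 'a \<Rightarrow> 'a) \<Rightarrow> ereal" where
  "s_dim X \<phi> = Inf (ereal ` {t. t \<ge> 0 \<and> psi X \<phi> t \<le> 1})"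

definition isometry :: "('a::metric_space \<Rightarrow> 'b::metric_space) \<Rightarrow> bool" where
  "isometry g \<longleftrightarrow> (\<forall>x y. dist (g x) (g y) = dist x y)"

definition similarity :: "('a::euclidean_space \<Rightarrow> 'a) \<Rightarrow> bool" where
  "similarity f \<longleftrightarrow> (\<exists>r>0. \<exists>g. isometry g \<and> f = (\<lambda>x. r *\<^sub>R x) \<circ> g)"

definition unit_square :: "(real^2) set" where
  "unit_square = {x. \<forall>i. 0 \<le> x $ i \<and> x $ i \<le> 1}"

text \<open>Similarities are maps of the whole space, so \<open>U\<close> need not lie in the space on which the
  system acts.\<close>

definition open_set_condition :: "(nat \<Rightarrow> 'a::topological_space \<Rightarrow> 'a) \<Rightarrow> bool" where
  "open_set_condition \<phi> \<longleftrightarrow> (\<exists>U. open U \<and> U \<noteq> {} \<and> (\<forall>i. \<phi> i ` U \<subseteq> U)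
     \<and> (\<forall>i j. i \<noteq> j \<longrightarrow> \<phi> i ` U \<inter> \<phi> j ` U = {}))"

definition similarity_iifs_on_square :: "(nat \<Rightarrow> real^2 \<Rightarrow> real^2) \<Rightarrow> bool" where
  "similarity_iifs_on_square \<phi> \<longleftrightarrow> iifs unit_square \<phi> \<and> (\<forall>i. similarity (\<phi> i))"

definition continuum :: "'a::topological_space set \<Rightarrow> bool" where
  "continuum S \<longleftrightarrow> compact S \<and> connected S"

definition curve_image :: "'a::topological_space set \<Rightarrow> bool" where
  "curve_image S \<longleftrightarrow> (\<exists>f. path f \<and> path_image f = S)"

definition hoelder_curve_image :: "'a::metric_space set \<Rightarrow> bool" where
  "hoelder_curve_image S \<longleftrightarrow> (\<exists>\<alpha>\<ge>1. \<exists>f. \<exists>H>0.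
     (\<forall>x\<in>{0..1}. \<forall>y\<in>{0..1}. dist (f x) (f y) \<le> H * \<bar>x - y\<bar> powr (1 / \<alpha>)) \<and> path_image f = S)"

end

theory Submission
  imports Defs "HOL-Real_Asymp.Real_Asymp"
begin

text \<open>All maps are homotheties \<open>z \<mapsto> r z + b\<close>, so a system is a family of squares with disjoint interiors.
  A U-shaped arrangement of grid cells forces the attractor to contain the left and bottom edges of the
  unit square, hence of every square of the system. A zigzag of columns of ever smaller squares accumulates
  at an edge of the U without otherwise touching it. Its columns may have any heights, because the total
  \<open>t\<close>-dimensional size of a column of \<open>N\<close> squares of side \<open>\<delta>\<close> is \<open>N \<delta>\<^sup>t \<le> \<delta>\<^bsup>t-1\<^esup>\<close> for \<open>t > 1\<close>.

  A path from the zigzag to the U must pass through the connectors between consecutive columns one after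
  another, and so oscillates with the heights \<open>d\<^sub>j\<close> of the columns. If these are bounded below, there is no
  such path, while the attractor is connected since the zigzag accumulates at the U. If they tend to \<open>0\<close>,
  the zigzag converges to a point, and the attractor is a curve. A \<open>1/\<alpha>\<close>-Hoelder path needs time at
  least of order \<open>d\<^sub>j\<^sup>\<alpha>\<close> for the \<open>j\<close>th oscillation, which is impossible when \<open>d\<^sub>j\<close> decays
  logarithmically.\<close>

section \<open>Attractors\<close>

text \<open>The attractor of an infinite system need not be closed: limits of points from infinitely
  many squares may escape. Here they lie on the line \<open>x = a\<close>, so the chain has to
  accumulate at a segment which the system generates itself; this is the purpose of the right arm of
  the U.

  The halving of the sides makes the stages fit together: the squares of column \<open>j\<close>
  occupy the distances from \<open>3 * \<delta> j\<close> to \<open>4 * \<delta> j\<close> to that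
  line, the connector those from \<open>2 * \<delta> j\<close> to \<open>3 * \<delta> j\<close>, and
  \<open>2 * \<delta> j = 4 * \<delta> (Suc j)\<close>. At distance
  \<open>5 / 2 * \<delta> j\<close> the chain consists of a single square, so the height of the
  attractor there is known up to \<open>\<delta> j\<close>, however complicated it is inside the
  squares.

  A curve onto the attractor must contain small copies of itself, so it is found as a fixed point in
  a space of paths; edges known to lie in the attractor serve as roads between the copies.

  The Hoelder obstruction needs \<open>J * (d J) powr \<alpha>\<close> unbounded for every
  \<open>\<alpha>\<close> although \<open>d\<close> tends to \<open>0\<close>. A power decay of
  \<open>d\<close> achieves this only for small \<open>\<alpha>\<close>, hence the
  logarithm.\<close>

lemma word_map_Suc_left: "word_map \<phi> s (Suc n) = \<phi> (s 0) \<circ> word_map \<phi> (s \<circ> Suc) n"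
  by (induction n) (simp_all add: fun_eq_iff)

lemma attractor_subset:
  assumes "\<And>i. \<phi> i ` X \<subseteq> X"
  shows "attractor X \<phi> \<subseteq> X"
proof
  fix x assume "x \<in> attractor X \<phi>"
  then obtain s where "\<forall>n\<in>{1..}. x \<in> word_map \<phi> s n ` X" by (auto simp: attractor_def)
  then have "x \<in> word_map \<phi> s (Suc 0) ` X" by force
  then show "x \<in> X" using assms by auto
qed

text \<open>Choosing for every point of \<open>C\<close> a map and a preimage in \<open>C\<close>,
  and iterating, produces an address: the chosen indices form \<open>s\<close>, and the
  \<open>n\<close>th preimage witnesses membership in the \<open>n\<close>th image of
  \<open>X\<close>.\<close>

lemma self_covered_subset_attractor:
  assumes "C \<subseteq> X" and cov: "C \<subseteq> (\<Union>i. \<phi> i ` C)"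
  shows "C \<subseteq> attractor X \<phi>"
proof
  fix x assume x: "x \<in> C"
  have "\<forall>y. \<exists>i z. y \<in> C \<longrightarrow> z \<in> C \<and> y = \<phi> i z" using cov by blast
  then obtain I Z where IZ: "\<And>y. y \<in> C \<Longrightarrow> Z y \<in> C \<and> y = \<phi> (I y) (Z y)" by metis
  define s where "s n = I ((Z ^^ n) x)" for n
  have ZC: "(Z ^^ n) x \<in> C" for n using x IZ by (induction n) auto
  have w: "x = word_map \<phi> s n ((Z ^^ n) x)" for n
  proof (induction n)
    case (Suc n)
    have "(Z ^^ n) x = \<phi> (s n) ((Z ^^ Suc n) x)" using IZ[OF ZC[of n]] by (simp add: s_def)
    then show ?case using Suc by (metis comp_apply word_map.simps(2))
  qed simp
  have "x \<in> word_map \<phi> s n ` X" for n using w[of n] ZC[of n] assms(1) by blast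
  then show "x \<in> attractor X \<phi>" unfolding attractor_def by blast
qed

lemma image_attractor_subset:
  assumes "\<And>i. \<phi> i ` X \<subseteq> X"
  shows "\<phi> i ` attractor X \<phi> \<subseteq> attractor X \<phi>"
proof (intro image_subsetI)
  fix x assume xa: "x \<in> attractor X \<phi>"
  then obtain s where s: "\<And>n. n \<ge> 1 \<Longrightarrow> x \<in> word_map \<phi> s n ` X" by (auto simp: attractor_def)
  \<comment> \<open>The attractor constrains only words of length at least \<open>1\<close>, but
    removing the prefix \<open>i\<close> from a word of length \<open>1\<close> leaves the empty
    word.\<close>
  have s': "x \<in> word_map \<phi> s n ` X" for n
    using s[of n] attractor_subset[of \<phi> X, OF assms] xa by (cases n) auto
  define s1 where "s1 = case_nat i s"
  have 1: "s1 \<circ> Suc = s" "s1 0 = i" by (auto simp: s1_def)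
  have "\<phi> i x \<in> word_map \<phi> s1 n ` X" if "n \<ge> 1" for n
  proof -
    from that obtain m where m: "n = Suc m" using not0_implies_Suc by fastforce
    show ?thesis using s'[of m] unfolding m word_map_Suc_left 1 by auto
  qed
  then show "\<phi> i x \<in> attractor X \<phi>" unfolding attractor_def by auto
qed

text \<open>By injectivity a single preimage under the outermost map serves all word lengths, so it
  lies in the whole intersection given by the shifted address.\<close>

lemma attractor_subset_UN:
  assumes "\<And>i. \<phi> i ` X \<subseteq> X" and inj: "\<And>i. inj (\<phi> i)"
  shows "attractor X \<phi> \<subseteq> (\<Union>i. \<phi> i ` attractor X \<phi>)"
proof
  fix x assume xa: "x \<in> attractor X \<phi>"
  then obtain s where s: "\<And>n. n \<ge> 1 \<Longrightarrow> x \<in> word_map \<phi> s n ` X" by (auto simp: attractor_def)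
  have "x \<in> \<phi> (s 0) ` word_map \<phi> (s \<circ> Suc) n ` X" for n
    using s[of "Suc n"] unfolding word_map_Suc_left by (simp add: image_comp)
  note w = this
  obtain y where y: "x = \<phi> (s 0) y" using w[of 0] by auto
  have "y \<in> word_map \<phi> (s \<circ> Suc) n ` X" for n
    using w[of n] inj_image_mem_iff[OF inj] unfolding y by blast
  then have "y \<in> attractor X \<phi>" unfolding attractor_def by blast
  then show "x \<in> (\<Union>i. \<phi> i ` attractor X \<phi>)" using y by blast
qed

text \<open>The points \<open>word_map \<phi> s n e\<close> with \<open>e\<close> in
  \<open>E\<close> stay in \<open>E\<close> and approach every point with address \<open>s\<close>,
  because the \<open>n\<close>th image of \<open>X\<close> has diameter at most
  \<open>\<rho>^n * B\<close>. Applied to a connected component and to the image of a path, this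
  shows that they exhaust the attractor.\<close>

lemma attractor_subset_invariant:
  assumes X: "\<And>i. \<phi> i ` X \<subseteq> X" "bounded X" and "\<rho> < 1" "\<rho> \<ge> 0"
    and lip: "\<And>i x y. x \<in> X \<Longrightarrow> y \<in> X \<Longrightarrow> dist (\<phi> i x) (\<phi> i y) \<le> \<rho> * dist x y"
    and E: "closed E" "E \<subseteq> X" "E \<noteq> {}" "\<And>i. \<phi> i ` E \<subseteq> E"
  shows "attractor X \<phi> \<subseteq> E"
proof
  fix x assume "x \<in> attractor X \<phi>"
  then obtain s where s: "\<And>n. n \<ge> 1 \<Longrightarrow> x \<in> word_map \<phi> s n ` X" by (auto simp: attractor_def)
  obtain e where e: "e \<in> E" using E by blast
  obtain B where B: "\<And>x y. x \<in> X \<Longrightarrow> y \<in> X \<Longrightarrow> dist x y \<le> B"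
    using X(2) bounded_two_points by metis
  have wX: "y \<in> X \<Longrightarrow> word_map \<phi> s n y \<in> X" for s n y
    using X(1) by (induction n arbitrary: y) auto
  have wE: "y \<in> E \<Longrightarrow> word_map \<phi> s n y \<in> E" for s n y
    using E(4) by (induction n arbitrary: y) auto
  have w: "y \<in> X \<Longrightarrow> z \<in> X \<Longrightarrow> dist (word_map \<phi> s n y) (word_map \<phi> s n z) \<le> \<rho>^n * B" for n y z
  proof (induction n arbitrary: s)
    case (Suc n)
    have "dist (word_map \<phi> s (Suc n) y) (word_map \<phi> s (Suc n) z)
       \<le> \<rho> * dist (word_map \<phi> (s \<circ> Suc) n y) (word_map \<phi> (s \<circ> Suc) n z)"
      unfolding word_map_Suc_left using lip wX Suc.prems by simp
    also have "\<dots> \<le> \<rho> * (\<rho>^n * B)" using Suc assms(4) by (intro mult_left_mono) auto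
    finally show ?case by simp
  qed (use B in auto)
  have d: "dist (word_map \<phi> s n e) x \<le> \<rho>^n * B" if "n \<ge> 1" for n
    using s[OF that] w[of e] e E(2) by auto
  have "(\<lambda>n. \<rho>^n * B) \<longlonglongrightarrow> 0"
    using assms by (intro tendsto_mult_left_zero LIMSEQ_power_zero) auto
  then have "(\<lambda>n. dist (word_map \<phi> s n e) x) \<longlonglongrightarrow> 0"
    by (rule Lim_null_comparison[rotated]) (use d in \<open>auto simp: eventually_sequentially\<close>)
  then have "(\<lambda>n. word_map \<phi> s n e) \<longlonglongrightarrow> x" using tendsto_dist_iff by blast
  then show "x \<in> E" using closed_sequentially[OF E(1), of "\<lambda>n. word_map \<phi> s n e"] wE[OF e] by blast
qed

text \<open>A subset of \<open>X\<close> covered by its own images lies in the attractor. Taking the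
  closure as that subset reduces closedness to a covering property, the point at which an infinite
  system can fail.\<close>

lemma closed_attractor:
  fixes X :: "'a::metric_space set"
  assumes "\<And>i. \<phi> i ` X \<subseteq> X" "closed X"
    and "closure (attractor X \<phi>) \<subseteq> (\<Union>i. \<phi> i ` closure (attractor X \<phi>))"
  shows "closed (attractor X \<phi>)"
proof -
  have "closure (attractor X \<phi>) \<subseteq> X" using attractor_subset[of \<phi> X] assms closure_minimal by blast
  then have "closure (attractor X \<phi>) \<subseteq> attractor X \<phi>"
    using self_covered_subset_attractor assms(3) by blast
  then show ?thesis using closure_subset_eq by blast
qed

section \<open>Infinite concatenation of paths\<close>

definition path_on_halfline :: "(nat \<Rightarrow> real \<Rightarrow> 'a) \<Rightarrow> real \<Rightarrow> 'a" where
  "path_on_halfline h x = h (nat \<lfloor>x\<rfloor>) (frac x)"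

text \<open>The time change \<open>t / (1 - t)\<close> maps \<open>[0, 1)\<close> onto the
  half-line, where the \<open>m\<close>th path occupies \<open>[m, m + 1]\<close>; \<open>p\<close>
  is meant to be the limit of the pieces.\<close>

definition infinite_join :: "(nat \<Rightarrow> real \<Rightarrow> 'a) \<Rightarrow> 'a \<Rightarrow> real \<Rightarrow> 'a" where
  "infinite_join h p t = (if t < 1 then path_on_halfline h (t / (1 - t)) else p)"

lemma path_on_halfline_add:
  assumes "\<And>m. pathfinish (h m) = pathstart (h (Suc m))" "0 \<le> s" "s \<le> 1"
  shows "path_on_halfline h (real m + s) = h m s"
proof (cases "s = 1")
  case True
  then show ?thesis using assms(1)[of m]
    by (simp add: path_on_halfline_def pathfinish_def pathstart_def nat_add_distrib frac_def)
next
  case False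
  then have "\<lfloor>real m + s\<rfloor> = int m" "frac (real m + s) = s"
    using assms by (linarith, simp add: frac_unique_iff)
  then show ?thesis by (simp add: path_on_halfline_def)
qed

lemma continuous_on_path_on_halfline:
  fixes h :: "nat \<Rightarrow> real \<Rightarrow> 'a::topological_space"
  assumes "\<And>m. pathfinish (h m) = pathstart (h (Suc m))" "\<And>m. path (h m)"
  shows "continuous_on {0..real N} (path_on_halfline h)"
proof (induction N)
  case (Suc N)
  have "continuous_on {real N..real (Suc N)} (\<lambda>x. h N (x - real N))"
    by (rule continuous_on_compose2[OF assms(2)[of N, unfolded path_def]]) (auto intro!: continuous_intros)
  moreover have "path_on_halfline h x = h N (x - real N)" if "x \<in> {real N..real (Suc N)}" for x
    using path_on_halfline_add[of h "x - real N" N] assms(1) that by auto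
  ultimately have "continuous_on {real N..real (Suc N)} (path_on_halfline h)"
    using continuous_on_cong by (metis (no_types, lifting))
  moreover have "{0..real (Suc N)} = {0..real N} \<union> {real N..real (Suc N)}" by auto
  ultimately show ?case using Suc continuous_on_closed_Un closed_atLeastAtMost by metis
qed (simp add: continuous_on_sing)

lemma infinite_join_at:
  assumes "\<And>m. pathfinish (h m) = pathstart (h (Suc m))" "0 \<le> s" "s \<le> 1"
  obtains t where "0 \<le> t" "t < 1" "infinite_join h p t = h m s"
proof -
  define x where "x = real m + s"
  define t where "t = x / (1 + x)"
  have x: "x \<ge> 0" using assms by (simp add: x_def)
  then have t: "t \<ge> 0" "t < 1" "t / (1 - t) = x" by (auto simp: t_def field_simps)
  then have "infinite_join h p t = h m s"
    using path_on_halfline_add[of h s m] assms by (simp add: infinite_join_def x_def)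
  then show ?thesis using t that by blast
qed

text \<open>The pair \<open>m\<close>, \<open>s\<close> depends on \<open>t\<close> alone and so
  serves two families at once; this makes infinite joins compatible with uniform distances. The
  bound on \<open>t / (1 - t)\<close> forces \<open>m\<close> to grow as \<open>t\<close> tends to
  \<open>1\<close>.\<close>

lemma infinite_join_eq:
  fixes h k :: "nat \<Rightarrow> real \<Rightarrow> 'a"
  assumes "0 \<le> t" "t < 1"
  obtains m s where "0 \<le> s" "s \<le> 1" "t / (1 - t) < real m + 1"
    "infinite_join h p t = h m s" "infinite_join k p t = k m s"
proof (rule that[of "frac (t / (1 - t))" "nat \<lfloor>t / (1 - t)\<rfloor>"])
  show "0 \<le> frac (t / (1 - t))" "frac (t / (1 - t)) \<le> 1"
    using frac_lt_1[of "t / (1 - t)"] by simp_all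
  have "0 \<le> t / (1 - t)" using assms by simp
  then show "t / (1 - t) < real (nat \<lfloor>t / (1 - t)\<rfloor>) + 1" by linarith
  show "infinite_join h p t = h (nat \<lfloor>t / (1 - t)\<rfloor>) (frac (t / (1 - t)))"
    "infinite_join k p t = k (nat \<lfloor>t / (1 - t)\<rfloor>) (frac (t / (1 - t)))"
    using assms by (simp_all add: infinite_join_def path_on_halfline_def)
qed

lemma
  fixes h :: "nat \<Rightarrow> real \<Rightarrow> 'a::metric_space"
  assumes j: "\<And>m. pathfinish (h m) = pathstart (h (Suc m))" and h: "\<And>m. path (h m)"
    and lim: "\<And>e. e > 0 \<Longrightarrow> \<exists>M. \<forall>m\<ge>M. path_image (h m) \<subseteq> cball p e"
  shows path_infinite_join: "path (infinite_join h p)"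
    and path_image_infinite_join: "path_image (infinite_join h p) = insert p (\<Union>m. path_image (h m))"
    and pathstart_infinite_join: "pathstart (infinite_join h p) = pathstart (h 0)"
    and pathfinish_infinite_join: "pathfinish (infinite_join h p) = p"
proof -
  show "pathstart (infinite_join h p) = pathstart (h 0)" "pathfinish (infinite_join h p) = p"
    by (auto simp: pathstart_def pathfinish_def infinite_join_def path_on_halfline_def)
  show "path_image (infinite_join h p) = insert p (\<Union>m. path_image (h m))"
  proof (intro equalityI subsetI)
    fix z assume "z \<in> path_image (infinite_join h p)"
    then obtain t where t: "0 \<le> t" "t \<le> 1" "z = infinite_join h p t" by (auto simp: path_image_def)
    show "z \<in> insert p (\<Union>m. path_image (h m))"
    proof (cases "t < 1")
      case True
      then show ?thesis using infinite_join_eq[OF t(1) True] t(3)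
        by (metis UN_I UNIV_I atLeastAtMost_iff imageI insertCI path_image_def)
    qed (use t in \<open>simp add: infinite_join_def\<close>)
  next
    fix z assume "z \<in> insert p (\<Union>m. path_image (h m))"
    then consider "z = p" | m s where "z = h m s" "0 \<le> s" "s \<le> 1" by (auto simp: path_image_def)
    then show "z \<in> path_image (infinite_join h p)"
    proof cases
      case 1
      then have "z = infinite_join h p 1" by (simp add: infinite_join_def)
      then show ?thesis by (auto simp: path_image_def)
    next
      case 2
      then show ?thesis using infinite_join_at[of h s p m] j
        by (metis atLeastAtMost_iff imageI less_imp_le path_image_def)
    qed
  qed
  have "continuous (at t within {0..1}) (infinite_join h p)" if t: "t \<in> {0..1}" for t
  proof (cases "t < 1")
    case True
    \<comment> \<open>Up to the midpoint \<open>u\<close> of \<open>t\<close> and \<open>1\<close>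
      only finitely many pieces are involved.\<close>
    define u where "u = (t + 1) / 2"
    have u: "t < u" "u < 1" using True by (auto simp: u_def)
    obtain N where N: "u / (1 - u) \<le> real N" using real_arch_simple by blast
    have mono: "v / (1 - v) \<le> real N" if "v \<le> u" for v
    proof -
      have "v / (1 - v) \<le> u / (1 - u)" using that u by (simp add: divide_simps) (simp add: algebra_simps)
      then show ?thesis using N by simp
    qed
    have "continuous_on {0..u} (\<lambda>v. path_on_halfline h (v / (1 - v)))"
      by (rule continuous_on_compose2[OF continuous_on_path_on_halfline[of h, OF j h, of N]])
        (use u mono in \<open>auto intro!: continuous_intros\<close>)
    moreover have "path_on_halfline h (v / (1 - v)) = infinite_join h p v" if "v \<in> {0..u}" for v
      using that u by (simp add: infinite_join_def)
    ultimately have "continuous_on {0..u} (infinite_join h p)"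
      using continuous_on_cong by (metis (no_types, lifting))
    then have "continuous (at t within {0..u}) (infinite_join h p)"
      using t u by (simp add: continuous_on_eq_continuous_within)
    moreover have "at t within {0..u} = at t within {0..1}"
      by (rule at_within_nhd[of _ "{..<u}"]) (use u in auto)
    ultimately show ?thesis by simp
  next
    case False
    then have t1: "t = 1" using t by simp
    have "\<exists>d>0. \<forall>v\<in>{0..1}. dist v 1 < d \<longrightarrow> dist (infinite_join h p v) p < e" if "e > 0" for e
    proof -
      obtain M where M: "\<And>m. m \<ge> M \<Longrightarrow> path_image (h m) \<subseteq> cball p (e / 2)"
        using lim[of "e / 2"] \<open>e > 0\<close> by auto
      have "dist (infinite_join h p v) p < e" if v: "v \<in> {0..1}" "dist v 1 < 1 / (real M + 1)" for v
      proof (cases "v < 1")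
        case True
        have "1 - v < 1 / (real M + 1)" using v by (auto simp: dist_real_def)
        then have "v / (1 - v) \<ge> real M" using True by (simp add: field_simps)
        moreover obtain m s where ms: "0 \<le> s" "s \<le> 1" "v / (1 - v) < real m + 1"
          "infinite_join h p v = h m s"
          using infinite_join_eq[of v] v True by (metis atLeastAtMost_iff)
        ultimately have "m \<ge> M" by linarith
        moreover have "h m s \<in> path_image (h m)" using ms(1,2) by (simp add: path_image_def)
        ultimately have "h m s \<in> cball p (e / 2)" using M by blast
        then show ?thesis using ms \<open>e > 0\<close> by (simp add: dist_commute)
      next
        case False
        then show ?thesis using that(1) \<open>e > 0\<close> by (simp add: infinite_join_def)
      qed
      then show ?thesis by (intro exI[of _ "1 / (real M + 1)"]) auto
    qed
    then have "(infinite_join h p \<longlongrightarrow> p) (at 1 within {0..1})"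
      unfolding Lim_within by blast
    then show ?thesis by (simp add: t1 continuous_within infinite_join_def)
  qed
  then show "path (infinite_join h p)" unfolding path_def by (simp add: continuous_on_eq_continuous_within)
qed

lemma dist_infinite_join_le:
  assumes "\<And>m t. t \<in> {0..1} \<Longrightarrow> dist (h m t) (k m t) \<le> c" "0 \<le> c" "t \<in> {0..1}"
  shows "dist (infinite_join h p t) (infinite_join k p t) \<le> c"
proof (cases "t < 1")
  case True
  obtain m s where "0 \<le> s" "s \<le> 1" "infinite_join h p t = h m s" "infinite_join k p t = k m s"
    using infinite_join_eq[of t] assms(3) True by (metis atLeastAtMost_iff)
  then show ?thesis using assms(1)[of s m] by simp
qed (use assms in \<open>simp add: infinite_join_def\<close>)

section \<open>Weaving paths\<close>

text \<open>A weave of the paths \<open>f\<close> in \<open>K\<close> starting at \<open>0\<close> is an operator turning \<open>f\<close> into a path from \<open>p\<close> to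
  \<open>q\<close> inside \<open>R\<close> that runs through the copies of \<open>f\<close> under the maps indexed by \<open>S\<close>, and that contracts the
  uniform distance. When \<open>S\<close> consists of all indices and \<open>p = 0\<close>, its fixed point is a path whose image
  is invariant under the whole system.\<close>

locale homothety_invariant =
  fixes K :: "'a::euclidean_space set" and I :: "'i set"
    and r :: "'i \<Rightarrow> real" and b :: "'i \<Rightarrow> 'a" and \<rho> :: real
  assumes compact_K: "compact K" and zero_K: "0 \<in> K"
    and map_K: "\<And>i z. i \<in> I \<Longrightarrow> z \<in> K \<Longrightarrow> r i *\<^sub>R z + b i \<in> K"
    and ratio: "\<And>i. i \<in> I \<Longrightarrow> 0 \<le> r i \<and> r i \<le> \<rho>" and rho: "0 \<le> \<rho>" "\<rho> < 1"
begin

text \<open>Starting at \<open>0\<close> makes the copy under the map \<open>i\<close> start at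
  \<open>b i\<close> for every path, so that copies can be attached at points known in
  advance.\<close>

definition based_paths :: "(real \<Rightarrow> 'a) set" where
  "based_paths = {f. path f \<and> pathstart f = 0 \<and> path_image f \<subseteq> K}"

definition weaving :: "((real \<Rightarrow> 'a) \<Rightarrow> real \<Rightarrow> 'a) \<Rightarrow> 'a set \<Rightarrow> 'i set \<Rightarrow> 'a \<Rightarrow> 'a \<Rightarrow> bool" where
  "weaving P R S p q \<longleftrightarrow>
     (\<forall>f\<in>based_paths. path (P f) \<and> pathstart (P f) = p \<and> pathfinish (P f) = q \<and> path_image (P f) \<subseteq> R
        \<and> (\<forall>i\<in>S. (\<lambda>z. r i *\<^sub>R z + b i) ` path_image f \<subseteq> path_image (P f)))
   \<and> (\<forall>f\<in>based_paths. \<forall>g\<in>based_paths. \<forall>c. (\<forall>t\<in>{0..1}. dist (f t) (g t) \<le> c)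
        \<longrightarrow> (\<forall>t\<in>{0..1}. dist (P f t) (P g t) \<le> \<rho> * c))"

definition weave :: "'a set \<Rightarrow> 'i set \<Rightarrow> 'a \<Rightarrow> 'a \<Rightarrow> bool" where
  "weave R S p q \<longleftrightarrow> (\<exists>P. weaving P R S p q)"

lemma weaveI:
  assumes "\<And>f. f \<in> based_paths \<Longrightarrow> path (P f)"
    "\<And>f. f \<in> based_paths \<Longrightarrow> pathstart (P f) = p"
    "\<And>f. f \<in> based_paths \<Longrightarrow> pathfinish (P f) = q"
    "\<And>f. f \<in> based_paths \<Longrightarrow> path_image (P f) \<subseteq> R"
    "\<And>f i. f \<in> based_paths \<Longrightarrow> i \<in> S \<Longrightarrow> (\<lambda>z. r i *\<^sub>R z + b i) ` path_image f \<subseteq> path_image (P f)"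
    "\<And>f g c t. f \<in> based_paths \<Longrightarrow> g \<in> based_paths \<Longrightarrow> 0 \<le> c \<Longrightarrow> (\<And>t. t \<in> {0..1} \<Longrightarrow> dist (f t) (g t) \<le> c)
        \<Longrightarrow> t \<in> {0..1} \<Longrightarrow> dist (P f t) (P g t) \<le> \<rho> * c"
  shows "weave R S p q"
  unfolding weave_def weaving_def
proof (intro exI[of _ P] conjI ballI allI impI)
  fix f g c t
  assume *: "f \<in> based_paths" "g \<in> based_paths" "\<forall>t\<in>{0..1}. dist (f t) (g t) \<le> c" "t \<in> {0..1::real}"
  then have "0 \<le> c" using zero_le_dist order_trans by blast
  then show "dist (P f t) (P g t) \<le> \<rho> * c" using assms(6)[of f g c t] * by blast
qed (use assms(1-5) in blast)+

lemma weavingD: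
  assumes "weaving P R S p q" "f \<in> based_paths"
  shows "path (P f)" "pathstart (P f) = p" "pathfinish (P f) = q" "path_image (P f) \<subseteq> R"
    "i \<in> S \<Longrightarrow> (\<lambda>z. r i *\<^sub>R z + b i) ` path_image f \<subseteq> path_image (P f)"
    "g \<in> based_paths \<Longrightarrow> (\<And>t. t \<in> {0..1} \<Longrightarrow> dist (f t) (g t) \<le> c)
        \<Longrightarrow> t \<in> {0..1} \<Longrightarrow> dist (P f t) (P g t) \<le> \<rho> * c"
  using assms unfolding weaving_def by blast+

lemma weave_subset:
  assumes "weave R S p q" "R \<subseteq> R'" "S' \<subseteq> S"
  shows "weave R' S' p q"
proof -
  obtain P where P: "weaving P R S p q" using assms(1) weave_def by blast
  show ?thesis
  proof (rule weaveI[of P])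
    show "path_image (P f) \<subseteq> R'" if "f \<in> based_paths" for f
      using weavingD(4)[OF P that] assms(2) by (rule subset_trans)
    show "(\<lambda>z. r i *\<^sub>R z + b i) ` path_image f \<subseteq> path_image (P f)" if "f \<in> based_paths" "i \<in> S'" for f i
      using weavingD(5)[OF P that(1)] assms(3) that(2) by (meson subsetD)
    show "dist (P f t) (P g t) \<le> \<rho> * c"
      if "f \<in> based_paths" "g \<in> based_paths" "\<And>t. t \<in> {0..1} \<Longrightarrow> dist (f t) (g t) \<le> c" "t \<in> {0..1}" for f g c t
      using weavingD(6)[OF P that] .
  qed (fact weavingD[OF P])+
qed

text \<open>A connecting segment does not depend on \<open>f\<close> and contributes distance
  \<open>0\<close>.\<close>

lemma weave_line:
  assumes "closed_segment p q \<subseteq> R"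
  shows "weave R {} p q"
  by (rule weaveI[of "\<lambda>_. linepath p q"]) (use assms rho in auto)

text \<open>Each operator uses the same half of the time interval for every \<open>f\<close>, so
  uniform distances combine by maximum and the factor \<open>\<rho>\<close> survives.\<close>

lemma weave_join:
  assumes "weave R S p q" "weave R T q s"
  shows "weave R (S \<union> T) p s"
proof -
  obtain P where "weaving P R S p q" using assms(1) weave_def by blast
  note P = weavingD[OF this]
  obtain Q where "weaving Q R T q s" using assms(2) weave_def by blast
  note Q = weavingD[OF this]
  show ?thesis
  proof (rule weaveI[of "\<lambda>f. P f +++ Q f"])
    fix f assume f: "f \<in> based_paths"
    then have im: "path_image (P f +++ Q f) = path_image (P f) \<union> path_image (Q f)"
      using P(3) Q(2) by (simp add: path_image_join)
    show "path (P f +++ Q f)" using P(1,3) Q(1,2) f by simp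
    show "pathstart (P f +++ Q f) = p" "pathfinish (P f +++ Q f) = s" using P(2) Q(3) f by auto
    show "path_image (P f +++ Q f) \<subseteq> R" using im P(4) Q(4) f by auto
    show "(\<lambda>z. r i *\<^sub>R z + b i) ` path_image f \<subseteq> path_image (P f +++ Q f)" if "i \<in> S \<union> T" for i
      using im P(5)[OF f, of i] Q(5)[OF f, of i] that by blast
  next
    fix f g c and t :: real
    assume *: "f \<in> based_paths" "g \<in> based_paths" "\<And>t. t \<in> {0..1} \<Longrightarrow> dist (f t) (g t) \<le> c" "t \<in> {0..1}"
    show "dist ((P f +++ Q f) t) ((P g +++ Q g) t) \<le> \<rho> * c"
      using P(6)[OF *(1-3), of "2 * t"] Q(6)[OF *(1-3), of "2 * t - 1"] *(4)
      by (auto simp: joinpaths_def)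
  qed
qed

lemma weave_reverse:
  assumes "weave R S p q"
  shows "weave R S q p"
proof -
  obtain P where "weaving P R S p q" using assms weave_def by blast
  note P = weavingD[OF this]
  show ?thesis
  proof (rule weaveI[of "\<lambda>f. reversepath (P f)"])
    fix f g c and t :: real
    assume *: "f \<in> based_paths" "g \<in> based_paths" "\<And>t. t \<in> {0..1} \<Longrightarrow> dist (f t) (g t) \<le> c" "t \<in> {0..1}"
    show "dist (reversepath (P f) t) (reversepath (P g) t) \<le> \<rho> * c"
      using P(6)[OF *(1-3), of "1 - t"] *(4) by (simp add: reversepath_def)
  qed (use P(1-5) in auto)
qed

text \<open>The copy of \<open>f\<close> is run through and then back: its end point varies with
  \<open>f\<close>, but its starting point is always \<open>b i\<close>.\<close>

lemma weave_loop:
  assumes "i \<in> I" "(\<lambda>z. r i *\<^sub>R z + b i) ` K \<subseteq> R"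
  shows "weave R {i} (b i) (b i)"
proof -
  define P where "P f = (\<lambda>z. r i *\<^sub>R z + b i) \<circ> f" for f :: "real \<Rightarrow> 'a"
  have cont: "continuous_on A (\<lambda>z. r i *\<^sub>R z + b i)" for A by (intro continuous_intros)
  have P: "path (P f)" "pathstart (P f) = b i" "path_image (P f) = (\<lambda>z. r i *\<^sub>R z + b i) ` path_image f"
    if "f \<in> based_paths" for f
    using that path_continuous_image[OF _ cont]
    by (auto simp: based_paths_def P_def pathstart_compose path_image_compose)
  show ?thesis
  proof (rule weaveI[of "\<lambda>f. P f +++ reversepath (P f)"])
    fix f assume f: "f \<in> based_paths"
    have im: "path_image (P f +++ reversepath (P f)) = path_image (P f)"
      by (simp add: path_image_join)
    show "path_image (P f +++ reversepath (P f)) \<subseteq> R" "pathstart (P f +++ reversepath (P f)) = b i"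
      "path (P f +++ reversepath (P f))" "pathfinish (P f +++ reversepath (P f)) = b i"
      using im f P(1,2)[OF f] P(3)[OF f] assms(2) by (auto simp: based_paths_def image_subset_iff)
    show "(\<lambda>z. r j *\<^sub>R z + b j) ` path_image f \<subseteq> path_image (P f +++ reversepath (P f))" if "j \<in> {i}" for j
      using im P(3)[OF f] that by auto
  next
    fix f g c and t :: real
    assume *: "f \<in> based_paths" "g \<in> based_paths" "0 \<le> c" "\<And>t. t \<in> {0..1} \<Longrightarrow> dist (f t) (g t) \<le> c" "t \<in> {0..1}"
    have "dist (P f t) (P g t) \<le> \<rho> * c" if "t \<in> {0..1}" for t
    proof -
      have "dist (P f t) (P g t) = r i * dist (f t) (g t)"
        using ratio[OF assms(1)] by (simp add: P_def dist_norm flip: scaleR_diff_right)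
      also have "\<dots> \<le> \<rho> * c" using ratio[OF assms(1)] *(4)[OF that] by (intro mult_mono) (use rho in auto)
      finally show ?thesis .
    qed
    note le = this
    show "dist ((P f +++ reversepath (P f)) t) ((P g +++ reversepath (P g)) t) \<le> \<rho> * c"
      using le[of "2 * t"] le[of "1 - (2 * t - 1)"] *(5)
      by (cases "t \<le> 1 / 2") (simp_all add: joinpaths_def reversepath_def)
  qed
qed

lemma weave_segment:
  assumes "\<And>u. lo \<le> u \<Longrightarrow> u \<le> hi \<Longrightarrow> p + u *\<^sub>R v \<in> R" "s \<in> {lo..hi}" "t \<in> {lo..hi}"
  shows "weave R {} (p + s *\<^sub>R v) (p + t *\<^sub>R v)"
proof (rule weave_line)
  show "closed_segment (p + s *\<^sub>R v) (p + t *\<^sub>R v) \<subseteq> R"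
  proof
    fix z assume "z \<in> closed_segment (p + s *\<^sub>R v) (p + t *\<^sub>R v)"
    then obtain l where l: "0 \<le> l" "l \<le> 1" "z = (1 - l) *\<^sub>R (p + s *\<^sub>R v) + l *\<^sub>R (p + t *\<^sub>R v)"
      by (auto simp: in_segment)
    have "z = p + ((1 - l) * s + l * t) *\<^sub>R v" unfolding l(3) by (simp add: algebra_simps)
    moreover have "(1 - l) * s + l * t \<in> {lo..hi}"
      using convexD_alt[OF convex_real_interval(5) assms(2,3) l(1,2)] by simp
    ultimately show "z \<in> R" using assms(1) by simp
  qed
qed

text \<open>The base points are evenly spaced on a segment inside \<open>R\<close>; the path walks
  along it and makes a loop at each of them. This serves the columns of the chain as well as the
  three sides of the U.\<close>

lemma weave_row:
  assumes s: "\<And>k. k < m \<Longrightarrow> s k \<in> I" "\<And>k. k < m \<Longrightarrow> b (s k) = p + (real k * c) *\<^sub>R v"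
    and R: "\<And>k z. k < m \<Longrightarrow> z \<in> K \<Longrightarrow> r (s k) *\<^sub>R z + b (s k) \<in> R"
      "\<And>u. 0 \<le> u \<Longrightarrow> u \<le> real m * c \<Longrightarrow> p + u *\<^sub>R v \<in> R"
    and "0 \<le> c" "k \<le> m"
  shows "weave R (s ` {..<k}) p (p + (real k * c) *\<^sub>R v)"
  using \<open>k \<le> m\<close>
proof (induction k)
  case 0
  have "p \<in> R" using R(2)[of 0] \<open>0 \<le> c\<close> by simp
  then show ?case by (simp add: weave_line)
next
  case (Suc k)
  then have k: "k < m" by simp
  have "weave R (s ` {..<k}) p (p + (real k * c) *\<^sub>R v)" using Suc by simp
  moreover have "weave R {s k} (p + (real k * c) *\<^sub>R v) (p + (real k * c) *\<^sub>R v)"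
    using weave_loop[of "s k" R] s k R(1)[OF k] by (simp add: image_subset_iff)
  moreover have "weave R {} (p + (real k * c) *\<^sub>R v) (p + (real (Suc k) * c) *\<^sub>R v)"
  proof (rule weave_segment[OF R(2)])
    show "real k * c \<in> {0..real m * c}" "real (Suc k) * c \<in> {0..real m * c}"
      using k \<open>0 \<le> c\<close> by (auto intro!: mult_right_mono simp del: of_nat_Suc)
  qed
  ultimately have "weave R (s ` {..<k} \<union> ({s k} \<union> {})) p (p + (real (Suc k) * c) *\<^sub>R v)"
    using weave_join by blast
  then show ?case by (simp add: lessThan_Suc insert_commute)
qed

text \<open>The pieces have to shrink to \<open>p\<close> uniformly in \<open>f\<close>, which is
  why a weave records a region containing all its paths.\<close>

lemma weave_infinite:
  assumes w: "\<And>m. weave (R m) (S m) (q m) (q (Suc m))" and sub: "\<And>m. R m \<subseteq> R'" "p \<in> R'"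
    and lim: "\<And>e. e > 0 \<Longrightarrow> \<exists>M. \<forall>m\<ge>M. R m \<subseteq> cball p e"
  shows "weave R' (\<Union>m. S m) (q 0) p"
proof -
  obtain P where P0: "\<And>m. weaving (P m) (R m) (S m) (q m) (q (Suc m))" using w unfolding weave_def by metis
  note P = weavingD[OF P0]
  define Q where "Q f = infinite_join (\<lambda>m. P m f) p" for f
  show ?thesis
  proof (rule weaveI[of Q])
    fix f assume f: "f \<in> based_paths"
    have l: "\<exists>M. \<forall>m\<ge>M. path_image (P m f) \<subseteq> cball p e" if "e > 0" for e
      using lim[OF that] P(4)[OF f] by (metis subset_trans)
    have j: "pathfinish (P m f) = pathstart (P (Suc m) f)" for m using P(2,3)[OF f] by simp
    have im: "path_image (Q f) = insert p (\<Union>m. path_image (P m f))"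
      unfolding Q_def by (rule path_image_infinite_join) (use j P(1)[OF f] l in auto)
    show "path (Q f)" unfolding Q_def by (rule path_infinite_join) (use j P(1)[OF f] l in auto)
    show "pathstart (Q f) = q 0" unfolding Q_def
      by (subst pathstart_infinite_join) (use j P(1,2)[OF f] l in auto)
    show "pathfinish (Q f) = p" unfolding Q_def
      by (rule pathfinish_infinite_join) (use j P(1)[OF f] l in auto)
    have "path_image (P m f) \<subseteq> R'" for m using P(4)[OF f, of m] sub(1)[of m] by (rule subset_trans)
    then show "path_image (Q f) \<subseteq> R'" using im sub(2) by (simp add: UN_subset_iff)
    show "(\<lambda>z. r i *\<^sub>R z + b i) ` path_image f \<subseteq> path_image (Q f)" if i: "i \<in> (\<Union>m. S m)" for i
    proof -
      obtain m where "i \<in> S m" using i by blast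
      then have "(\<lambda>z. r i *\<^sub>R z + b i) ` path_image f \<subseteq> path_image (P m f)" by (rule P(5)[OF f])
      also have "\<dots> \<subseteq> path_image (Q f)" unfolding im by blast
      finally show ?thesis .
    qed
  next
    fix f g c and t :: real
    assume *: "f \<in> based_paths" "g \<in> based_paths" "0 \<le> c" "\<And>t. t \<in> {0..1} \<Longrightarrow> dist (f t) (g t) \<le> c" "t \<in> {0..1}"
    show "dist (Q f t) (Q g t) \<le> \<rho> * c" unfolding Q_def
    proof (rule dist_infinite_join_le)
      show "dist (P m f t) (P m g t) \<le> \<rho> * c" if "t \<in> {0..1}" for m t
        using P(6)[OF *(1,2,4) that] .
    qed (use *(3,5) rho in auto)
  qed
qed

text \<open>Weaving the constant path \<open>0\<close> already gives a path in \<open>K\<close>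
  through \<open>p\<close>, \<open>q\<close> and every \<open>b i\<close> with \<open>i\<close> in
  \<open>S\<close>.\<close>

lemma weave_connected_component:
  assumes "weave K S p q"
  shows "connected_component K p q" "i \<in> S \<Longrightarrow> connected_component K p (b i)"
proof -
  have f: "(\<lambda>_. 0) \<in> based_paths"
    using zero_K by (auto simp: based_paths_def path_def pathstart_def path_image_def)
  obtain P where "weaving P K S p q" using assms weave_def by blast
  note P = weavingD[OF this f]
  have c: "connected (path_image (P (\<lambda>_. 0)))" using P(1) by (rule connected_path_image)
  have p: "p \<in> path_image (P (\<lambda>_. 0))" "q \<in> path_image (P (\<lambda>_. 0))"
    using pathstart_in_path_image[of "P (\<lambda>_. 0)"] pathfinish_in_path_image[of "P (\<lambda>_. 0)"] P(2,3) by simp_all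
  show "connected_component K p q" unfolding connected_component_def using c p P(4) by blast
  show "connected_component K p (b i)" if "i \<in> S"
  proof -
    have "r i *\<^sub>R 0 + b i \<in> path_image (P (\<lambda>_. 0))"
      by (rule subsetD[OF P(5)[OF that] imageI]) (simp add: path_image_def)
    then show ?thesis unfolding connected_component_def using c p(1) P(4) by auto
  qed
qed

text \<open>Banach iteration of \<open>P\<close> from the constant path: the iterates converge
  uniformly to a fixed path, whose image then contains its own copies.\<close>

lemma weave_fixed_path:
  assumes "weave K I 0 q"
  obtains g where "g \<in> based_paths"
    "\<And>i. i \<in> I \<Longrightarrow> (\<lambda>z. r i *\<^sub>R z + b i) ` path_image g \<subseteq> path_image g"
proof -
  obtain P where "weaving P K I 0 q" using assms weave_def by blast
  note PD = weavingD[OF this]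
  note P = PD(1,2,4,5,6)
  define F where "F n = (P ^^ n) (\<lambda>_. 0)" for n
  have F0: "F 0 = (\<lambda>_. 0)" and FS: "F (Suc n) = P (F n)" for n by (auto simp: F_def)
  have Fb: "F n \<in> based_paths" for n
  proof (induction n)
    case 0
    show ?case using zero_K by (auto simp: F0 based_paths_def path_def pathstart_def path_image_def)
  next
    case (Suc n)
    then show ?case unfolding FS using P(1-3) by (simp add: based_paths_def)
  qed
  have FK: "F n t \<in> K" if "t \<in> {0..1}" for n t
    using Fb[of n] that by (auto simp: based_paths_def path_image_def)
  obtain D where D: "\<And>x y. x \<in> K \<Longrightarrow> y \<in> K \<Longrightarrow> dist x y \<le> D"
    using compact_imp_bounded[OF compact_K] bounded_two_points by metis
  have step: "\<forall>t\<in>{0..1}. dist (F (Suc n) t) (F n t) \<le> \<rho>^n * D" for n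
  proof (induction n)
    case 0
    show ?case using D FK by simp
  next
    case (Suc n)
    have "\<forall>t\<in>{0..1}. dist (P (F (Suc n)) t) (P (F n) t) \<le> \<rho> * (\<rho>^n * D)"
      using P(5)[OF Fb Fb] Suc by blast
    then show ?case by (simp add: FS mult.assoc)
  qed
  \<comment> \<open>The increments decay geometrically, and their partial sums telescope to
    \<open>F n\<close> because \<open>F 0\<close> is \<open>0\<close>.\<close>
  define g where "g t = (\<Sum>n. F (Suc n) t - F n t)" for t
  have "uniform_limit {0..1} (\<lambda>n t. \<Sum>i<n. F (Suc i) t - F i t) g sequentially"
    unfolding g_def
    by (rule Weierstrass_m_test[where M="\<lambda>n. \<rho>^n * D"])
      (use step rho in \<open>auto simp: dist_norm intro!: summable_mult2 summable_geometric\<close>)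
  then have lim: "uniform_limit {0..1} F g sequentially"
  proof -
    have "(\<Sum>i<n. F (Suc i) t - F i t) = F n t" for n t
      using sum_lessThan_telescope[of "\<lambda>i. F i t" n] by (simp add: F0)
    then show ?thesis using \<open>uniform_limit {0..1} _ g sequentially\<close> by simp
  qed
  have "continuous_on {0..1} g"
    by (rule uniform_limit_theorem[OF _ lim]) (use Fb in \<open>auto simp: based_paths_def path_def\<close>)
  moreover have pw: "(\<lambda>n. F n t) \<longlonglongrightarrow> g t" if "t \<in> {0..1}" for t
    using tendsto_uniform_limitI[OF lim that] .
  moreover have "g t \<in> K" if "t \<in> {0..1}" for t
    using closed_sequentially[OF compact_imp_closed[OF compact_K] _ pw[OF that]] FK that by blast
  moreover have "g 0 = 0"
    using LIMSEQ_unique[OF pw[of 0], of 0] Fb by (simp add: based_paths_def pathstart_def)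
  ultimately have gb: "g \<in> based_paths"
    by (auto simp: based_paths_def path_def pathstart_def path_image_def)
  \<comment> \<open>Uniform distances are controlled only on \<open>[0, 1]\<close>; equality there
    suffices for the images.\<close>
  have fixed: "P g t = g t" if t: "t \<in> {0..1}" for t
  proof -
    have "(\<lambda>n. F (Suc n) t) \<longlonglongrightarrow> P g t"
    proof (rule metric_LIMSEQ_I)
      fix e :: real assume "e > 0"
      then obtain N where N: "\<And>n t. n \<ge> N \<Longrightarrow> t \<in> {0..1} \<Longrightarrow> dist (F n t) (g t) < e"
        using uniform_limitD[OF lim] unfolding eventually_sequentially by metis
      have "dist (F (Suc n) t) (P g t) < e" if "n \<ge> N" for n
      proof -
        have "dist (P (F n) t) (P g t) \<le> \<rho> * e"
          using P(5)[OF Fb gb _ t] N[OF that] by (meson less_imp_le)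
        also have "\<dots> < e" using rho \<open>e > 0\<close> by simp
        finally show ?thesis by (simp add: FS)
      qed
      then show "\<exists>N. \<forall>n\<ge>N. dist (F (Suc n) t) (P g t) < e" by blast
    qed
    moreover have "(\<lambda>n. F (Suc n) t) \<longlonglongrightarrow> g t" using pw[OF t] LIMSEQ_Suc by blast
    ultimately show ?thesis using LIMSEQ_unique by blast
  qed
  then have "path_image (P g) = path_image g" unfolding path_image_def by (intro image_cong) auto
  then show ?thesis using that[OF gb] P(4)[OF gb] by simp
qed

end

section \<open>Oscillation along a chain of levels\<close>

text \<open>Here \<open>t j\<close> is the first time at which \<open>u\<close> along
  \<open>g\<close> is at most \<open>l j\<close>. Lower levels are reached later, and by the
  intermediate value theorem the level is attained exactly.\<close>

lemma level_times:
  fixes u :: "'a::topological_space \<Rightarrow> real"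
  assumes g: "path g" and u: "continuous_on (path_image g) u" and l: "decseq l"
    and l0: "l 0 < u (pathstart g)" and l1: "\<And>j. u (pathfinish g) \<le> l j"
  obtains t :: "nat \<Rightarrow> real" where "incseq t" "\<And>j. t j \<in> {0..1}" "\<And>j. u (g (t j)) = l j"
proof -
  define h where "h = u \<circ> g"
  have h: "continuous_on {0..1} h"
    unfolding h_def using g u by (intro continuous_on_compose) (auto simp: path_def path_image_def)
  define S where "S j = {s \<in> {0..1}. h s \<le> l j}" for j
  define t where "t j = Inf (S j)" for j
  have S1: "1 \<in> S j" for j using l1[of j] by (simp add: S_def h_def pathfinish_def)
  have Sb: "bdd_below (S j)" for j by (intro bdd_belowI[of _ 0]) (auto simp: S_def)
  have "closed (S j)" for j
  proof -
    have "closed ({0..1} \<inter> h -` {..l j})" by (intro continuous_closed_preimage h) auto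
    moreover have "S j = {0..1} \<inter> h -` {..l j}" by (auto simp: S_def)
    ultimately show ?thesis by simp
  qed
  then have tS: "t j \<in> S j" for j
    unfolding t_def using S1 Sb by (intro closed_contains_Inf) auto
  then have t01: "t j \<in> {0..1}" and tle: "h (t j) \<le> l j" for j by (auto simp: S_def)
  have "h (t j) = l j" for j
  proof -
    have "l j \<le> h 0" using l0 decseqD[OF l, of 0 j] by (simp add: h_def pathstart_def)
    then obtain s where s: "0 \<le> s" "s \<le> t j" "h s = l j"
      using IVT2'[of h "t j" "l j" 0] tle[of j] t01[of j] continuous_on_subset[OF h] by auto
    then have "s \<in> S j" using t01[of j] by (auto simp: S_def)
    then have "t j \<le> s" unfolding t_def using Sb by (intro cInf_lower)
    then show ?thesis using s by auto
  qed
  moreover have "incseq t"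
  proof (intro incseq_SucI)
    fix j
    have "S (Suc j) \<subseteq> S j" using decseq_SucD[OF l, of j] by (auto simp: S_def)
    then show "t j \<le> t (Suc j)" unfolding t_def using S1 Sb by (intro cInf_superset_mono) auto
  qed
  ultimately show ?thesis using that[of t] t01 by (simp add: h_def)
qed

text \<open>The level times along a path from \<open>p\<close> to \<open>q\<close> increase to a
  limit \<open>T\<close>. Continuity of \<open>v\<close> along the path at \<open>T\<close> forces
  consecutive differences to \<open>0\<close>, while each is at least \<open>c\<close>.\<close>

lemma not_path_connected_if_oscillating:
  fixes u v :: "'a::topological_space \<Rightarrow> real"
  assumes u: "continuous_on K u" and v: "continuous_on K v" and l: "decseq l"
    and p: "p \<in> K" "l 0 < u p" and q: "q \<in> K" "\<And>j. u q \<le> l j" and "0 < c"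
    and osc: "\<And>j x y. x \<in> K \<Longrightarrow> y \<in> K \<Longrightarrow> u x = l j \<Longrightarrow> u y = l (Suc j) \<Longrightarrow> c \<le> \<bar>v x - v y\<bar>"
  shows "\<not> path_connected K"
proof
  assume "path_connected K"
  then obtain g where g: "path g" "path_image g \<subseteq> K" "pathstart g = p" "pathfinish g = q"
    using p(1) q(1) unfolding path_connected_def by blast
  obtain t where t: "incseq t" "\<And>j. t j \<in> {0..1}" "\<And>j. u (g (t j)) = l j"
    using level_times[OF g(1) continuous_on_subset[OF u g(2)] l] p(2) q(2) g(3,4) by metis
  have gK: "g (t j) \<in> K" for j using g(2) t(2) by (auto simp: path_image_def)
  obtain T where T: "t \<longlonglongrightarrow> T" using incseq_convergent[OF t(1)] t(2) by (metis atLeastAtMost_iff)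
  then have T01: "T \<in> {0..1}" by (rule closed_sequentially[OF closed_atLeastAtMost, rotated]) (use t(2) in auto)
  have vg: "continuous_on {0..1} (v \<circ> g)"
    using g continuous_on_subset[OF v g(2)] by (intro continuous_on_compose) (auto simp: path_def path_image_def)
  have lim: "(\<lambda>j. (v \<circ> g) (t j)) \<longlonglongrightarrow> (v \<circ> g) T"
    by (rule continuous_on_tendsto_compose[OF vg T T01]) (simp only: t(2) eventually_True)
  have "(\<lambda>j. \<bar>(v \<circ> g) (t j) - (v \<circ> g) (t (Suc j))\<bar>) \<longlonglongrightarrow> \<bar>(v \<circ> g) T - (v \<circ> g) T\<bar>"
    by (rule tendsto_rabs[OF tendsto_diff[OF lim LIMSEQ_Suc[OF lim]]])
  then have "c \<le> \<bar>(v \<circ> g) T - (v \<circ> g) T\<bar>"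
    by (rule LIMSEQ_le_const) (use osc[OF gK gK t(3) t(3)] in \<open>simp only: comp_apply, blast\<close>)
  then show False using \<open>0 < c\<close> by simp
qed

lemma hoelder_imp_continuous_on:
  fixes f :: "real \<Rightarrow> 'a::metric_space"
  assumes "0 < \<alpha>" "0 < H"
    and f: "\<And>x y. x \<in> S \<Longrightarrow> y \<in> S \<Longrightarrow> dist (f x) (f y) \<le> H * \<bar>x - y\<bar> powr (1 / \<alpha>)"
  shows "continuous_on S f"
  unfolding continuous_on_iff
proof (intro ballI allI impI)
  fix x e :: real assume x: "x \<in> S" and e: "0 < e"
  have "dist (f y) (f x) < e" if y: "y \<in> S" "dist y x < (e / H) powr \<alpha>" for y
  proof -
    have "\<bar>y - x\<bar> powr (1 / \<alpha>) < ((e / H) powr \<alpha>) powr (1 / \<alpha>)"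
      using y(2) assms by (intro powr_less_mono2) (auto simp: dist_real_def)
    also have "\<dots> = e / H" using assms e by (simp add: powr_powr)
    finally have "H * \<bar>y - x\<bar> powr (1 / \<alpha>) < e" using assms by (simp add: field_simps)
    then show ?thesis using f[OF y(1) x] by linarith
  qed
  then show "\<exists>d>0. \<forall>y\<in>S. dist y x < d \<longrightarrow> dist (f y) (f x) < e"
    using assms e by (intro exI[of _ "(e / H) powr \<alpha>"]) auto
qed

text \<open>The oscillation between levels \<open>j\<close> and \<open>j + 1\<close> takes time at
  least \<open>(c j / H) powr \<alpha>\<close>. As \<open>c\<close> decreases, the first
  \<open>J\<close> of these times sum to at least \<open>J\<close> times the bound at
  \<open>J\<close>, and yet they fit into \<open>[0, 1]\<close>.\<close>

lemma not_hoelder_if_oscillating: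
  fixes u v :: "'a::metric_space \<Rightarrow> real"
  assumes u: "continuous_on K u" and v: "\<And>x y. \<bar>v x - v y\<bar> \<le> dist x y" and l: "decseq l"
    and p: "p \<in> K" "l 0 < u p" and q: "q \<in> K" "\<And>j. u q \<le> l j"
    and c: "decseq c" "\<And>j. 0 < c j"
    and osc: "\<And>j x y. x \<in> K \<Longrightarrow> y \<in> K \<Longrightarrow> u x = l j \<Longrightarrow> u y = l (Suc j) \<Longrightarrow> c j \<le> \<bar>v x - v y\<bar>"
    and big: "\<And>\<alpha> H. 1 \<le> \<alpha> \<Longrightarrow> 0 < H \<Longrightarrow> \<exists>J. 1 < real J * (c J / H) powr \<alpha>"
  shows "\<not> hoelder_curve_image K"
proof
  assume "hoelder_curve_image K"
  then obtain \<alpha> f H where \<alpha>: "1 \<le> \<alpha>" and H: "0 < H"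
    and f: "\<And>x y. x \<in> {0..1} \<Longrightarrow> y \<in> {0..1} \<Longrightarrow> dist (f x) (f y) \<le> H * \<bar>x - y\<bar> powr (1 / \<alpha>)"
    and K: "path_image f = K"
    unfolding hoelder_curve_image_def by blast
  obtain a b where ab: "a \<in> {0..1}" "f a = p" "b \<in> {0..1}" "f b = q"
    using p(1) q(1) K unfolding path_image_def by blast
  \<comment> \<open>The preimages of \<open>p\<close> and \<open>q\<close> may come in either order;
    this affine change of time covers both and does not enlarge the Hoelder constant, as
    \<open>\<bar>b - a\<bar> \<le> 1\<close>.\<close>
  define g where "g x = f (a + x * (b - a))" for x
  have in01: "a + x * (b - a) \<in> {0..1}" if "x \<in> {0..1}" for x
  proof -
    have "a + x * (b - a) = (1 - x) * a + x * b" by (simp add: algebra_simps)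
    then show ?thesis using convexD_alt[OF convex_real_interval(5)[of 0 1], of a b x] ab that by auto
  qed
  have gh: "dist (g x) (g y) \<le> H * \<bar>x - y\<bar> powr (1 / \<alpha>)" if "x \<in> {0..1}" "y \<in> {0..1}" for x y
  proof -
    have "\<bar>a + x * (b - a) - (a + y * (b - a))\<bar> = \<bar>x - y\<bar> * \<bar>b - a\<bar>"
      by (simp add: algebra_simps flip: abs_mult)
    also have "\<dots> \<le> \<bar>x - y\<bar>" using ab by (intro mult_left_le) auto
    finally have "\<bar>a + x * (b - a) - (a + y * (b - a))\<bar> powr (1 / \<alpha>) \<le> \<bar>x - y\<bar> powr (1 / \<alpha>)"
      using \<alpha> by (intro powr_mono2) auto
    then have "H * \<bar>a + x * (b - a) - (a + y * (b - a))\<bar> powr (1 / \<alpha>) \<le> H * \<bar>x - y\<bar> powr (1 / \<alpha>)"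
      using H by simp
    then show ?thesis using f[OF in01 in01, OF that] unfolding g_def by (rule order_trans[rotated])
  qed
  have gp: "path g" unfolding path_def
    by (rule hoelder_imp_continuous_on[of \<alpha> H]) (use gh \<alpha> H in auto)
  have gi: "path_image g \<subseteq> K" using in01 K by (auto simp: path_image_def g_def)
  have "pathstart g = p" "pathfinish g = q" using ab by (auto simp: g_def pathstart_def pathfinish_def)
  then obtain t where t: "incseq t" "\<And>j. t j \<in> {0..1}" "\<And>j. u (g (t j)) = l j"
    using level_times[OF gp continuous_on_subset[OF u gi] l] p(2) q(2) by metis
  have gK: "g (t j) \<in> K" for j using gi t(2) by (auto simp: path_image_def)
  have step: "(c j / H) powr \<alpha> \<le> t (Suc j) - t j" for j
  proof -
    have mono: "t j \<le> t (Suc j)" using t(1) by (simp add: incseq_SucD)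
    have "c j \<le> \<bar>v (g (t j)) - v (g (t (Suc j)))\<bar>" by (rule osc[OF gK gK t(3) t(3)])
    also have "\<dots> \<le> dist (g (t j)) (g (t (Suc j)))" by (rule v)
    also have "\<dots> \<le> H * \<bar>t j - t (Suc j)\<bar> powr (1 / \<alpha>)" by (rule gh[OF t(2) t(2)])
    finally have "c j / H \<le> (t (Suc j) - t j) powr (1 / \<alpha>)"
      using H mono by (simp add: field_simps abs_minus_commute)
    then have "(c j / H) powr \<alpha> \<le> ((t (Suc j) - t j) powr (1 / \<alpha>)) powr \<alpha>"
      using c(2)[of j] H \<alpha> by (intro powr_mono2) auto
    also have "\<dots> = t (Suc j) - t j" using mono \<alpha> by (simp add: powr_powr)
    finally show ?thesis .
  qed
  obtain J where J: "1 < real J * (c J / H) powr \<alpha>" using big[OF \<alpha> H] by blast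
  have "real J * (c J / H) powr \<alpha> = (\<Sum>j<J. (c J / H) powr \<alpha>)" by simp
  also have "\<dots> \<le> (\<Sum>j<J. t (Suc j) - t j)"
  proof (intro sum_mono)
    fix j assume "j \<in> {..<J}"
    then have "c J \<le> c j" using decseqD[OF c(1)] by simp
    then have "(c J / H) powr \<alpha> \<le> (c j / H) powr \<alpha>"
      using c(2)[of J] H \<alpha> by (intro powr_mono2 divide_right_mono) auto
    then show "(c J / H) powr \<alpha> \<le> t (Suc j) - t j" using step[of j] by linarith
  qed
  also have "\<dots> = t J - t 0" by (rule sum_lessThan_telescope)
  also have "\<dots> \<le> 1" using t(2)[of J] t(2)[of 0] by auto
  finally show False using J by simp
qed

section \<open>Homotheties: Lipschitz constants and similarity dimension\<close>

lemma Lip_homothety: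
  fixes b :: "'a::real_normed_vector"
  assumes "0 < r" "x \<in> X" "y \<in> X" "x \<noteq> y"
  shows "Lip X (\<lambda>z. r *\<^sub>R z + b) = r"
proof -
  have "L-lipschitz_on X (\<lambda>z. r *\<^sub>R z + b) \<longleftrightarrow> r \<le> L" for L
  proof
    assume "L-lipschitz_on X (\<lambda>z. r *\<^sub>R z + b)"
    then have "dist (r *\<^sub>R x + b) (r *\<^sub>R y + b) \<le> L * dist x y" using lipschitz_onD assms(2,3) by metis
    then show "r \<le> L" using assms by (simp add: dist_norm flip: scaleR_diff_right)
  next
    assume "r \<le> L"
    then show "L-lipschitz_on X (\<lambda>z. r *\<^sub>R z + b)"
      using assms(1) by (auto intro!: lipschitz_onI mult_right_mono simp: dist_norm simp flip: scaleR_diff_right)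
  qed
  then have "{L. L > 0 \<and> L-lipschitz_on X (\<lambda>z. r *\<^sub>R z + b)} = {r..}" using assms(1) by auto
  then show ?thesis by (simp add: Lip_def)
qed

lemma similarity_homothety:
  assumes "0 < r"
  shows "similarity (\<lambda>z. r *\<^sub>R z + b)"
  unfolding similarity_def
proof (intro exI conjI)
  show "isometry (\<lambda>x. x + (1 / r) *\<^sub>R b)" by (simp add: isometry_def)
  show "(\<lambda>z. r *\<^sub>R z + b) = (\<lambda>x. r *\<^sub>R x) \<circ> (\<lambda>x. x + (1 / r) *\<^sub>R b)"
    using assms by (auto simp: scaleR_add_right)
qed (fact assms)

lemma s_dim_le:
  assumes "0 \<le> t" "\<And>N. (\<Sum>i<N. Lip X (\<phi> i) powr t) \<le> 1"
  shows "s_dim X \<phi> \<le> ereal t"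
proof -
  have "psi X \<phi> t \<le> 1" unfolding psi_def
  proof (rule suminf_le_const)
    show "(\<Sum>i<N. ennreal (Lip X (\<phi> i) powr t)) \<le> 1" for N
      using assms(2)[of N] by (simp add: sum_ennreal)
  qed (simp add: summableI)
  then show ?thesis unfolding s_dim_def using assms(1) by (intro Inf_lower) auto
qed

section \<open>The zigzag system\<close>

abbreviation pt :: "real \<Rightarrow> real \<Rightarrow> real^2" where "pt x y \<equiv> vector [x, y]"

lemma pt_eqI: "z $ 1 = x \<Longrightarrow> z $ 2 = y \<Longrightarrow> z = pt x y"
  by (simp add: vec_eq_iff forall_2)

lemma mem_unit_square: "z \<in> unit_square \<longleftrightarrow> 0 \<le> z $ 1 \<and> z $ 1 \<le> 1 \<and> 0 \<le> z $ 2 \<and> z $ 2 \<le> 1"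
  by (auto simp: unit_square_def forall_2)

lemma compact_unit_square: "compact unit_square"
proof -
  have "unit_square = cbox (pt 0 0) (pt 1 1)"
    by (auto simp: mem_unit_square cbox_def Basis_vec_def inner_axis forall_2 mem_box_cart)
  then show ?thesis by (metis compact_cbox)
qed

datatype square_index = Grid nat nat | Col nat nat | Con nat

instance square_index :: countable by countable_datatype

text \<open>\<open>Grid p q\<close> are the cells of the \<open>n \<times> n\<close> grid forming a U. The other squares form a chain that
  approaches the left edge \<open>x = a\<close> of the right arm of the U: \<open>Col j k\<close> is the \<open>k\<close>th square of the \<open>j\<close>th
  column, and \<open>Con j\<close> connects the columns \<open>j\<close> and \<open>j + 1\<close>, near the top of the column (at height about
  \<open>d j\<close> above \<open>1 / 2\<close>) for even \<open>j\<close> and at its bottom for odd \<open>j\<close>.\<close>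

locale zigzag =
  fixes n :: nat and \<delta>\<^sub>0 :: real and d :: "nat \<Rightarrow> real"
  assumes n: "4 \<le> n" and \<delta>\<^sub>0: "0 < \<delta>\<^sub>0" "\<delta>\<^sub>0 \<le> 1 / 128"
    and d: "decseq d" "\<And>j. d j \<le> 1 / 10" and d_ge: "\<And>j. 8 * (\<delta>\<^sub>0 / 2 ^ j) \<le> d j"
begin

definition a :: real where "a = 1 - 1 / real n"

definition \<delta> :: "nat \<Rightarrow> real" where "\<delta> j = \<delta>\<^sub>0 / 2 ^ j"

text \<open>Rounding down to the grid of column \<open>j\<close> places the connector level with a
  square of that column, so that their bottom edges form one segment.\<close>

definition \<kappa> :: "nat \<Rightarrow> nat" where "\<kappa> j = (if even j then nat \<lfloor>d j / \<delta> j\<rfloor> else 0)"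

text \<open>In the grid of column \<open>j + 1\<close>, which is twice as fine, connector \<open>j\<close> sits at index \<open>2 * \<kappa> j\<close>. One of
  \<open>\<kappa> j\<close> and \<open>\<kappa> (Suc j)\<close> is \<open>0\<close>, so the sum below is a maximum.\<close>

definition N :: "nat \<Rightarrow> nat" where
  "N j = (case j of 0 \<Rightarrow> \<kappa> 0 + 1 | Suc i \<Rightarrow> 2 * \<kappa> i + \<kappa> (Suc i) + 1)"

definition I :: "square_index set" where
  "I = {Grid p q | p q. p < n \<and> q < n \<and> (p = 0 \<or> q = 0 \<or> p = n - 1)}
     \<union> {Col j k | j k. k < N j} \<union> range Con"

fun r :: "square_index \<Rightarrow> real" where
  "r (Grid p q) = 1 / real n"
| "r (Col j k) = \<delta> j"
| "r (Con j) = \<delta> j"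

fun b :: "square_index \<Rightarrow> real^2" where
  "b (Grid p q) = pt (real p / real n) (real q / real n)"
| "b (Col j k) = pt (a - 4 * \<delta> j) (1 / 2 + real k * \<delta> j)"
| "b (Con j) = pt (a - 3 * \<delta> j) (1 / 2 + real (\<kappa> j) * \<delta> j)"

section \<open>Numerical bounds for the squares\<close>

lemma a: "3 / 4 \<le> a" "a \<le> 1" "1 / real n \<le> 1 / 4" "0 < 1 / real n"
  using n by (auto simp: a_def field_simps)

lemma grid_last: "real (n - 1) / real n = a"
  using n by (simp add: a_def field_simps of_nat_diff)

lemma \<delta>_pos: "0 < \<delta> j" using \<delta>\<^sub>0 by (simp add: \<delta>_def)

lemma \<delta>_Suc: "\<delta> j = 2 * \<delta> (Suc j)" by (simp add: \<delta>_def)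

lemma decseq_\<delta>: "decseq \<delta>"
  by (intro decseq_SucI) (use \<delta>_Suc \<delta>_pos in \<open>smt (verit)\<close>)

lemma \<delta>_le: "\<delta> j \<le> 1 / 128"
proof -
  have "\<delta> 0 = \<delta>\<^sub>0" by (simp add: \<delta>_def)
  then show ?thesis using decseqD[OF decseq_\<delta>, of 0 j] \<delta>\<^sub>0(2) by linarith
qed

lemma \<delta>_less: "i < j \<Longrightarrow> 2 * \<delta> j \<le> \<delta> i"
  using decseqD[OF decseq_\<delta>, of "Suc i" j] \<delta>_Suc[of i] by simp

lemma \<delta>_tendsto_0: "\<delta> \<longlonglongrightarrow> 0"
  unfolding \<delta>_def by (rule LIMSEQ_divide_realpow_zero) simp

lemma d_\<delta>: "8 * \<delta> j \<le> d j" using d_ge[of j] by (simp add: \<delta>_def)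

lemma \<kappa>_le: "real (\<kappa> j) * \<delta> j \<le> d j"
proof (cases "even j")
  case True
  have "0 \<le> d j / \<delta> j" using d_\<delta>[of j] \<delta>_pos[of j] by simp
  then have "real (nat \<lfloor>d j / \<delta> j\<rfloor>) \<le> d j / \<delta> j" by simp
  then show ?thesis using True \<delta>_pos[of j] by (simp add: \<kappa>_def field_simps)
next
  case False
  then show ?thesis using d_\<delta>[of j] \<delta>_pos[of j] by (simp add: \<kappa>_def)
qed

lemma \<kappa>_ge: "even j \<Longrightarrow> d j - \<delta> j \<le> real (\<kappa> j) * \<delta> j"
proof -
  assume "even j"
  have "d j / \<delta> j - 1 \<le> real (nat \<lfloor>d j / \<delta> j\<rfloor>)" by linarith
  then show ?thesis using \<open>even j\<close> \<delta>_pos[of j] by (simp add: \<kappa>_def field_simps)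
qed

lemma \<kappa>_less_N: "\<kappa> j < N j" "2 * \<kappa> j < N (Suc j)"
  by (auto simp: N_def split: nat.splits)

lemma N_0_\<delta>: "real (N 0) * \<delta> 0 = real (\<kappa> 0) * \<delta> 0 + \<delta> 0"
  by (simp add: N_def algebra_simps)

lemma N_Suc_\<delta>: "real (N (Suc j)) * \<delta> (Suc j) = real (\<kappa> j) * \<delta> j + real (\<kappa> (Suc j)) * \<delta> (Suc j) + \<delta> (Suc j)"
  using \<delta>_Suc[of j] by (simp add: N_def algebra_simps)

text \<open>The two adjacent connectors account for at most \<open>1 / 10\<close> each and the extra
  square for at most \<open>1 / 128\<close>. Hence the chain stays below height
  \<open>3 / 4\<close>.\<close>

lemma N_\<delta>_le: "real (N j) * \<delta> j \<le> 1 / 4"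
proof (cases j)
  case 0
  then show ?thesis using N_0_\<delta> \<kappa>_le[of 0] d(2)[of 0] \<delta>_le[of 0] by simp
next
  case (Suc i)
  then show ?thesis
    using N_Suc_\<delta>[of i] \<kappa>_le[of i] \<kappa>_le[of j] d(2)[of i] d(2)[of j] \<delta>_le[of j] by simp
qed

lemma Suc_k_\<delta>_le:
  assumes "k < N j"
  shows "real k * \<delta> j + \<delta> j \<le> real (N j) * \<delta> j"
proof -
  have "(real k + 1) * \<delta> j \<le> real (N j) * \<delta> j"
    using assms \<delta>_pos[of j] by (intro mult_right_mono) auto
  then show ?thesis by (simp add: algebra_simps)
qed

lemma Col_in_I [simp]: "Col j k \<in> I \<longleftrightarrow> k < N j" and Con_in_I [simp]: "Con j \<in> I"
  and Grid_in_I [simp]: "Grid p q \<in> I \<longleftrightarrow> p < n \<and> q < n \<and> (p = 0 \<or> q = 0 \<or> p = n - 1)"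
  by (auto simp: I_def)

lemma I_cases:
  assumes "i \<in> I"
  obtains p q where "i = Grid p q" "p < n" "q < n" "p = 0 \<or> q = 0 \<or> p = n - 1"
  | j k where "i = Col j k" "k < N j"
  | j where "i = Con j"
  using assms by (auto simp: I_def)

lemma r_pos: "0 < r i" using n \<delta>_pos by (cases i) auto

lemma r_le: "r i \<le> 1 / 4"
proof -
  have "\<delta> j \<le> 1 / 4" for j using \<delta>_le[of j] by simp
  then show ?thesis using a(3) by (cases i) auto
qed

text \<open>A common box for all squares of stage \<open>j\<close>, so that most arguments need not
  distinguish columns from connectors.\<close>

lemma zigzag_square_bounds:
  assumes "i = Col j k \<and> k < N j \<or> i = Con j"
  shows "a - 4 * \<delta> j \<le> b i $ 1" "b i $ 1 + r i \<le> a - 2 * \<delta> j"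
    "1 / 2 \<le> b i $ 2" "b i $ 2 + r i \<le> 1 / 2 + real (N j) * \<delta> j"
  using assms \<delta>_pos[of j] Suc_k_\<delta>_le[of k j] Suc_k_\<delta>_le[OF \<kappa>_less_N(1), of j] by auto

lemma square_bounds:
  assumes "i \<in> I"
  shows "0 \<le> b i $ 1" "b i $ 1 + r i \<le> 1" "0 \<le> b i $ 2" "b i $ 2 + r i \<le> 1"
proof -
  have *: "0 \<le> b i $ 1 \<and> b i $ 1 + r i \<le> 1 \<and> 0 \<le> b i $ 2 \<and> b i $ 2 + r i \<le> 1"
    if "i = Col j k \<and> k < N j \<or> i = Con j" for j k
    using zigzag_square_bounds[OF that] \<delta>_pos[of j] \<delta>_le[of j] N_\<delta>_le[of j] a by auto
  have "0 \<le> b i $ 1 \<and> b i $ 1 + r i \<le> 1 \<and> 0 \<le> b i $ 2 \<and> b i $ 2 + r i \<le> 1"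
    using assms
  proof (cases rule: I_cases)
    case (1 p q)
    then show ?thesis by (auto simp: field_simps)
  qed (use * in blast)+
  then show "0 \<le> b i $ 1" "b i $ 1 + r i \<le> 1" "0 \<le> b i $ 2" "b i $ 2 + r i \<le> 1" by auto
qed

section \<open>Disjointness of the interiors of the squares\<close>

definition separated :: "square_index \<Rightarrow> square_index \<Rightarrow> bool" where
  "separated i i' \<longleftrightarrow> b i $ 1 + r i \<le> b i' $ 1 \<or> b i' $ 1 + r i' \<le> b i $ 1
     \<or> b i $ 2 + r i \<le> b i' $ 2 \<or> b i' $ 2 + r i' \<le> b i $ 2"

lemma separated_sym: "separated i i' \<Longrightarrow> separated i' i"
  by (auto simp: separated_def)

lemma nat_scaled_separated:
  fixes c :: real
  assumes "k \<noteq> k'" "0 < c"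
  shows "real k * c + c \<le> real k' * c \<or> real k' * c + c \<le> real k * c"
proof -
  have "real k + 1 \<le> real k' \<or> real k' + 1 \<le> real k" using assms(1) by linarith
  then have "(real k + 1) * c \<le> real k' * c \<or> (real k' + 1) * c \<le> real k * c"
    using assms(2) by simp
  then show ?thesis by (simp add: algebra_simps)
qed

lemma separated_grid:
  assumes "Grid p q \<in> I" "Grid p' q' \<in> I" "Grid p q \<noteq> Grid p' q'"
  shows "separated (Grid p q) (Grid p' q')"
proof -
  have "p \<noteq> p' \<or> q \<noteq> q'" using assms(3) by simp
  then show ?thesis
    using nat_scaled_separated[of p p' "1 / real n"] nat_scaled_separated[of q q' "1 / real n"] a(4)
    by (auto simp: separated_def)
qed

text \<open>The chain lies in the bay of the U: to the right of \<open>1 / 2\<close>, above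
  \<open>1 / 2\<close> and to the left of \<open>a\<close>, whereas the left arm and the base have
  width \<open>1 / real n \<le> 1 / 4\<close>.\<close>

lemma separated_grid_zigzag:
  assumes "Grid p q \<in> I" "i = Col j k \<and> k < N j \<or> i = Con j"
  shows "separated (Grid p q) i"
proof -
  note z = zigzag_square_bounds[OF assms(2)]
  have "1 / 2 \<le> b i $ 1" "b i $ 1 + r i \<le> a" "1 / 2 \<le> b i $ 2"
    using z \<delta>_pos[of j] \<delta>_le[of j] a by auto
  moreover have "p = 0 \<or> q = 0 \<or> p = n - 1" using assms(1) by simp
  ultimately show ?thesis using a(3) grid_last by (auto simp: separated_def)
qed

text \<open>Different stages are separated horizontally, since
  \<open>2 * \<delta> j' \<le> \<delta> j\<close> for \<open>j < j'\<close>. Within a stage the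
  column squares differ in height and the connector lies to their right.\<close>

lemma separated_zigzag:
  assumes "i = Col j k \<and> k < N j \<or> i = Con j" "i' = Col j' k' \<and> k' < N j' \<or> i' = Con j'" "i \<noteq> i'"
  shows "separated i i'"
proof -
  have less: "separated i i'"
    if "i = Col j k \<and> k < N j \<or> i = Con j" "i' = Col j' k' \<and> k' < N j' \<or> i' = Con j'" "j < j'"
    for i i' j k j' k'
    using zigzag_square_bounds(2)[OF that(1)] zigzag_square_bounds(1)[OF that(2)] \<delta>_less[OF that(3)]
    by (simp add: separated_def)
  consider "j < j'" | "j' < j" | "j = j'" by linarith
  then show ?thesis
  proof cases
    case 3
    have "i = Col j k \<Longrightarrow> i' = Col j k' \<Longrightarrow> separated i i'"
      using nat_scaled_separated[of k k' "\<delta> j"] \<delta>_pos[of j] assms(3)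
      by (auto simp: separated_def)
    then show ?thesis using assms 3 by (auto simp: separated_def)
  qed (use less[OF assms(1,2)] less[OF assms(2,1)] separated_sym in blast)+
qed

lemma I_cases2:
  assumes "i \<in> I"
  obtains p q where "i = Grid p q" | j k where "i = Col j k \<and> k < N j \<or> i = Con j"
  using assms by (auto elim: I_cases)

lemma separated:
  assumes "i \<in> I" "i' \<in> I" "i \<noteq> i'"
  shows "separated i i'"
  using assms(1)
proof (cases rule: I_cases2)
  case (1 p q)
  note g = this
  from assms(2) show ?thesis
  proof (cases rule: I_cases2)
    case (1 p' q')
    then show ?thesis using g separated_grid assms by blast
  next
    case (2 j k)
    then show ?thesis using g separated_grid_zigzag assms by blast
  qed
next
  case (2 j k)
  note g = this
  from assms(2) show ?thesis
  proof (cases rule: I_cases2)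
    case (1 p' q')
    then show ?thesis using g separated_grid_zigzag separated_sym assms by blast
  next
    case (2 j' k')
    then show ?thesis using g separated_zigzag assms by blast
  qed
qed

lemma infinite_I: "infinite I"
proof -
  have "range Con \<subseteq> I" by auto
  moreover have "infinite (range Con)" by (rule range_inj_infinite) (auto simp: inj_def)
  ultimately show ?thesis using infinite_super by blast
qed

section \<open>The squares enumerated as an iterated function system\<close>

definition \<phi> :: "nat \<Rightarrow> real^2 \<Rightarrow> real^2" where
  "\<phi> m = (\<lambda>z. r (from_nat_into I m) *\<^sub>R z + b (from_nat_into I m))"

lemma bij_from_nat: "bij_betw (from_nat_into I) UNIV I"
  using infinite_I by (intro bij_betw_from_nat_into) auto

lemma from_nat_in_I: "from_nat_into I m \<in> I"
  using infinite_I by (intro from_nat_into) auto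

lemma from_nat_eq: "from_nat_into I m = from_nat_into I m' \<longleftrightarrow> m = m'"
  using bij_from_nat by (auto simp: bij_betw_def inj_on_def)

lemma obtain_nat:
  assumes "i \<in> I"
  obtains m where "\<phi> m = (\<lambda>z. r i *\<^sub>R z + b i)"
proof -
  obtain m where "from_nat_into I m = i"
    using bij_betw_imp_surj_on[OF bij_from_nat] assms by (metis imageE)
  then have "\<phi> m = (\<lambda>z. r i *\<^sub>R z + b i)" by (simp add: \<phi>_def)
  then show ?thesis by (rule that)
qed

lemma open_set_condition_\<phi>: "open_set_condition \<phi>"
  unfolding open_set_condition_def
proof (intro exI conjI allI impI)
  let ?U = "{z :: real^2. (0 < z $ 1 \<and> z $ 1 < 1) \<and> (0 < z $ 2 \<and> z $ 2 < 1)}"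
  show "open ?U" by (intro open_Collect_conj open_Collect_less continuous_intros)
  show "?U \<noteq> {}" by (auto intro!: exI[of _ "pt (1/2) (1/2)"])
  have im: "b (from_nat_into I m) $ 1 < w $ 1 \<and> w $ 1 < b (from_nat_into I m) $ 1 + r (from_nat_into I m)
      \<and> b (from_nat_into I m) $ 2 < w $ 2 \<and> w $ 2 < b (from_nat_into I m) $ 2 + r (from_nat_into I m)"
    if "w \<in> \<phi> m ` ?U" for m w
    using that r_pos[of "from_nat_into I m"] by (auto simp: \<phi>_def)
  show "\<phi> m ` ?U \<subseteq> ?U" for m
  proof
    fix w assume "w \<in> \<phi> m ` ?U"
    then show "w \<in> ?U" using im[of w m] square_bounds[OF from_nat_in_I[of m]] by simp
  qed
  show "\<phi> m ` ?U \<inter> \<phi> m' ` ?U = {}" if "m \<noteq> m'" for m m'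
  proof -
    have sep: "separated (from_nat_into I m) (from_nat_into I m')"
      using that by (intro separated from_nat_in_I) (simp add: from_nat_eq)
    have False if "w \<in> \<phi> m ` ?U" "w \<in> \<phi> m' ` ?U" for w
      using im[OF that(1)] im[OF that(2)] sep unfolding separated_def by linarith
    then show ?thesis by blast
  qed
qed

lemma map_square:
  assumes "i \<in> I" "z \<in> unit_square"
  shows "b i $ 1 \<le> (r i *\<^sub>R z + b i) $ 1" "(r i *\<^sub>R z + b i) $ 1 \<le> b i $ 1 + r i"
    "b i $ 2 \<le> (r i *\<^sub>R z + b i) $ 2" "(r i *\<^sub>R z + b i) $ 2 \<le> b i $ 2 + r i"
    "r i *\<^sub>R z + b i \<in> unit_square"
proof -
  have "0 \<le> r i * z $ 1" "r i * z $ 1 \<le> r i" "0 \<le> r i * z $ 2" "r i * z $ 2 \<le> r i"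
    using assms(2) r_pos[of i] by (auto simp: mem_unit_square mult_left_le)
  then show "b i $ 1 \<le> (r i *\<^sub>R z + b i) $ 1" "(r i *\<^sub>R z + b i) $ 1 \<le> b i $ 1 + r i"
    "b i $ 2 \<le> (r i *\<^sub>R z + b i) $ 2" "(r i *\<^sub>R z + b i) $ 2 \<le> b i $ 2 + r i"
    "r i *\<^sub>R z + b i \<in> unit_square"
    using square_bounds[OF assms(1)] by (auto simp: mem_unit_square)
qed

lemma \<phi>_square: "\<phi> m ` unit_square \<subseteq> unit_square"
  using map_square(5)[OF from_nat_in_I] by (auto simp: \<phi>_def)

lemma Lip_\<phi>: "Lip unit_square (\<phi> m) = r (from_nat_into I m)"
  unfolding \<phi>_def
  by (rule Lip_homothety[OF r_pos, of "pt 0 0" _ "pt 1 1"]) (auto simp: mem_unit_square vec_eq_iff forall_2)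

lemma dist_\<phi>_eq: "dist (\<phi> m x) (\<phi> m y) = r (from_nat_into I m) * dist x y"
  using r_pos[of "from_nat_into I m"] by (simp add: \<phi>_def dist_norm flip: scaleR_diff_right)

lemma dist_\<phi>: "dist (\<phi> m x) (\<phi> m y) \<le> 1 / 4 * dist x y"
  unfolding dist_\<phi>_eq using r_le by (intro mult_right_mono) auto

lemma similarity_iifs_on_square_\<phi>: "similarity_iifs_on_square \<phi>"
  unfolding similarity_iifs_on_square_def iifs_def
proof (intro conjI allI impI)
  show "compact unit_square" by (rule compact_unit_square)
  show "contraction_on unit_square (\<phi> m)" for m
    unfolding contraction_on_def
    using \<phi>_square dist_\<phi> by (auto intro!: exI[of _ "1 / 4"] lipschitz_onI)
  show "0 < Lip unit_square (\<phi> m)" "Lip unit_square (\<phi> m) < 1" for m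
    unfolding Lip_\<phi> using r_pos r_le[of "from_nat_into I m"] by auto
  show "similarity (\<phi> m)" for m unfolding \<phi>_def by (rule similarity_homothety[OF r_pos])
  show "\<exists>x\<in>unit_square. \<phi> m x \<noteq> \<phi> m' x" if "m \<noteq> m'" for m m'
  proof (rule ccontr)
    assume "\<not> (\<exists>x\<in>unit_square. \<phi> m x \<noteq> \<phi> m' x)"
    then have eq: "\<phi> m x = \<phi> m' x" if "x \<in> unit_square" for x using that by blast
    \<comment> \<open>Evaluation at \<open>0\<close> shows that the two squares share their lower
      left corner, which separated squares of positive side cannot do.\<close>
    have b: "b (from_nat_into I m) = b (from_nat_into I m')"
      using eq[of 0] by (simp add: \<phi>_def mem_unit_square)
    have "separated (from_nat_into I m) (from_nat_into I m')"
      using that by (intro separated from_nat_in_I) (simp add: from_nat_eq)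
    then show False
      using b r_pos[of "from_nat_into I m"] r_pos[of "from_nat_into I m'"] by (auto simp: separated_def)
  qed
qed

section \<open>Edges contained in the attractor\<close>

abbreviation K :: "(real^2) set" where "K \<equiv> attractor unit_square \<phi>"

lemma K_square: "K \<subseteq> unit_square" by (rule attractor_subset[OF \<phi>_square])

lemma map_K: "i \<in> I \<Longrightarrow> z \<in> K \<Longrightarrow> r i *\<^sub>R z + b i \<in> K"
  using image_attractor_subset[of \<phi> unit_square, OF \<phi>_square] by (metis image_subset_iff obtain_nat)

lemma K_cases:
  assumes "z \<in> K"
  obtains i w where "i \<in> I" "w \<in> K" "z = r i *\<^sub>R w + b i"
proof -
  have inj: "inj (\<phi> m)" for m
  proof (rule injI)
    show "x = y" if "\<phi> m x = \<phi> m y" for x y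
      using that r_pos[of "from_nat_into I m"] unfolding \<phi>_def by simp
  qed
  from attractor_subset_UN[of \<phi> unit_square, OF \<phi>_square inj] assms
  have "z \<in> (\<Union>m. \<phi> m ` K)" by (rule subsetD)
  then obtain m w where "w \<in> K" "z = \<phi> m w" by (elim UN_E imageE)
  then show ?thesis using that[OF from_nat_in_I, of w m] unfolding \<phi>_def by blast
qed

lemma K_subset:
  assumes "closed E" "E \<subseteq> unit_square" "E \<noteq> {}" "\<And>i z. i \<in> I \<Longrightarrow> z \<in> E \<Longrightarrow> r i *\<^sub>R z + b i \<in> E"
  shows "K \<subseteq> E"
  by (rule attractor_subset_invariant[where \<rho>="1 / 4"])
    (use assms \<phi>_square compact_imp_bounded[OF compact_unit_square] dist_\<phi> from_nat_in_I in
      \<open>auto simp: \<phi>_def image_subset_iff\<close>)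

lemma nat_cell:
  assumes "0 \<le> y" "y \<le> real m * c" "0 < c" "0 < m"
  obtains q where "q < m" "real q * c \<le> y" "y \<le> real q * c + c"
\<comment> \<open>The right end point belongs to the last cell; rounding down would give the index
  \<open>m\<close>.\<close>
proof (cases "y = real m * c")
  case True
  have "real m * c = real (m - 1) * c + c" using assms(4) by (simp add: of_nat_diff algebra_simps)
  then have "m - 1 < m" "real (m - 1) * c \<le> y" "y \<le> real (m - 1) * c + c"
    using True assms(3,4) by auto
  then show ?thesis by (rule that)
next
  case False
  define q where "q = nat \<lfloor>y / c\<rfloor>"
  have "0 \<le> y / c" using assms by simp
  then have "real q \<le> y / c" "y / c < real q + 1" unfolding q_def by linarith+
  then have q: "real q * c \<le> y" "y < real q * c + c" using assms(3) by (auto simp: field_simps)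
  then have "real q * c < real m * c" using False assms(2) by linarith
  then have "q < m" using assms(3) by simp
  from this q(1) less_imp_le[OF q(2)] show ?thesis by (rule that)
qed

text \<open>The union of the left and bottom edges is covered by its copies in the left arm and the
  base of the U: each cell of the left arm contributes part of the left edge, each cell of the base
  part of the bottom edge.\<close>

lemma edges_K:
  assumes "z \<in> unit_square" "z $ 1 = 0 \<or> z $ 2 = 0"
  shows "z \<in> K"
proof -
  let ?C = "{z \<in> unit_square. z $ 1 = 0 \<or> z $ 2 = 0}"
  have "?C \<subseteq> (\<Union>m. \<phi> m ` ?C)"
  proof
    fix z :: "real^2" assume z: "z \<in> ?C"
    have "\<exists>i\<in>I. \<exists>w\<in>?C. z = r i *\<^sub>R w + b i"
    proof (cases "z $ 1 = 0")
      case True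
      obtain q where q: "q < n" "real q * (1 / real n) \<le> z $ 2" "z $ 2 \<le> real q * (1 / real n) + 1 / real n"
        by (rule nat_cell[of "z $ 2" n "1 / real n"]) (use z n in \<open>auto simp: mem_unit_square\<close>)
      have "pt 0 (real n * z $ 2 - real q) \<in> ?C" using q n by (auto simp: mem_unit_square field_simps)
      moreover have "z = r (Grid 0 q) *\<^sub>R pt 0 (real n * z $ 2 - real q) + b (Grid 0 q)"
        using True n by (simp add: vec_eq_iff forall_2 field_simps)
      moreover have "Grid 0 q \<in> I" using q n by simp
      ultimately show ?thesis by blast
    next
      case False
      obtain q where q: "q < n" "real q * (1 / real n) \<le> z $ 1" "z $ 1 \<le> real q * (1 / real n) + 1 / real n"
        by (rule nat_cell[of "z $ 1" n "1 / real n"]) (use z n in \<open>auto simp: mem_unit_square\<close>)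
      have "pt (real n * z $ 1 - real q) 0 \<in> ?C" using q n by (auto simp: mem_unit_square field_simps)
      moreover have "z = r (Grid q 0) *\<^sub>R pt (real n * z $ 1 - real q) 0 + b (Grid q 0)"
        using False z n by (simp add: vec_eq_iff forall_2 field_simps)
      moreover have "Grid q 0 \<in> I" using q n by simp
      ultimately show ?thesis by blast
    qed
    then obtain i w where "i \<in> I" "w \<in> ?C" "z = r i *\<^sub>R w + b i" by blast
    then show "z \<in> (\<Union>m. \<phi> m ` ?C)" using obtain_nat by (metis (no_types, lifting) UN_I UNIV_I imageI)
  qed
  then have "?C \<subseteq> K" by (intro self_covered_subset_attractor) auto
  then show ?thesis using assms by blast
qed

lemma zero_K: "0 \<in> K" by (rule edges_K) (auto simp: mem_unit_square)

lemma left_edge_K: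
  assumes "i \<in> I" "b i $ 2 \<le> y" "y \<le> b i $ 2 + r i"
  shows "pt (b i $ 1) y \<in> K"
proof -
  have "0 \<le> (y - b i $ 2) / r i" "(y - b i $ 2) / r i \<le> 1"
    using divide_right_mono[of 0 "y - b i $ 2" "r i"] divide_right_mono[of "y - b i $ 2" "r i" "r i"]
      assms(2,3) r_pos[of i] by simp_all
  then have "pt 0 ((y - b i $ 2) / r i) \<in> K" by (intro edges_K) (simp_all add: mem_unit_square)
  then have "r i *\<^sub>R pt 0 ((y - b i $ 2) / r i) + b i \<in> K" by (rule map_K[OF assms(1)])
  moreover have "r i *\<^sub>R pt 0 ((y - b i $ 2) / r i) + b i = pt (b i $ 1) y"
    using r_pos[of i] by (intro pt_eqI) simp_all
  ultimately show ?thesis by simp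
qed

lemma bottom_edge_K:
  assumes "i \<in> I" "b i $ 1 \<le> x" "x \<le> b i $ 1 + r i"
  shows "pt x (b i $ 2) \<in> K"
proof -
  have "0 \<le> (x - b i $ 1) / r i" "(x - b i $ 1) / r i \<le> 1"
    using divide_right_mono[of 0 "x - b i $ 1" "r i"] divide_right_mono[of "x - b i $ 1" "r i" "r i"]
      assms(2,3) r_pos[of i] by simp_all
  then have "pt ((x - b i $ 1) / r i) 0 \<in> K" by (intro edges_K) (simp_all add: mem_unit_square)
  then have "r i *\<^sub>R pt ((x - b i $ 1) / r i) 0 + b i \<in> K" by (rule map_K[OF assms(1)])
  moreover have "r i *\<^sub>R pt ((x - b i $ 1) / r i) 0 + b i = pt x (b i $ 2)"
    using r_pos[of i] by (intro pt_eqI) simp_all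
  ultimately show ?thesis by simp
qed

lemma right_column_K:
  assumes "0 \<le> y" "y \<le> 1"
  shows "pt a y \<in> K"
proof -
  obtain q where q: "q < n" "real q * (1 / real n) \<le> y" "y \<le> real q * (1 / real n) + 1 / real n"
    by (rule nat_cell[of y n "1 / real n"]) (use assms n in auto)
  then show ?thesis using left_edge_K[of "Grid (n - 1) q" y] n grid_last by simp
qed

lemma column_K:
  assumes "1 / 2 \<le> y" "y \<le> 1 / 2 + real (N j) * \<delta> j"
  shows "pt (a - 4 * \<delta> j) y \<in> K"
proof -
  obtain q where q: "q < N j" "real q * \<delta> j \<le> y - 1 / 2" "y - 1 / 2 \<le> real q * \<delta> j + \<delta> j"
    by (rule nat_cell[of "y - 1 / 2" "N j" "\<delta> j"]) (use assms \<delta>_pos \<kappa>_less_N[of j] in auto)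
  then show ?thesis using left_edge_K[of "Col j q" y] by simp
qed

section \<open>Compactness of the attractor\<close>

definition stage :: "nat \<Rightarrow> square_index set" where "stage j = insert (Con j) (Col j ` {..<N j})"

definition frame :: "square_index set" where
  "frame = Grid 0 ` {..<n} \<union> (\<lambda>p. Grid p 0) ` {..<n} \<union> Grid (n - 1) ` {..<n}"

lemma I_eq: "I = frame \<union> (\<Union>j. stage j)"
  using n by (auto simp: frame_def stage_def elim!: I_cases)

lemma finite_frame: "finite frame" and finite_stage: "finite (stage j)"
  by (auto simp: frame_def stage_def)

text \<open>A limit of points of the attractor either lies in the image of the closure under one of
  finitely many maps, or is approached by ever later stages and ends up on the line
  \<open>x = a\<close>, inside the right arm.\<close>

lemma closed_K: "closed K"
proof (rule closed_attractor[OF \<phi>_square compact_imp_closed[OF compact_unit_square]])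
  let ?cK = "closure K"
  have cK: "?cK \<subseteq> unit_square"
    using K_square compact_imp_closed[OF compact_unit_square] by (rule closure_minimal)
  have compact_cK: "compact ?cK"
    using cK compact_unit_square by (metis compact_closure bounded_subset compact_imp_bounded K_square)
  show "?cK \<subseteq> (\<Union>m. \<phi> m ` ?cK)"
  proof
    fix z assume z: "z \<in> ?cK"
    let ?W = "\<Union>i\<in>I. (\<lambda>z. r i *\<^sub>R z + b i) ` ?cK"
    have "z \<in> ?W"
    proof (rule ccontr)
      assume nW: "z \<notin> ?W"
      have "a - 4 * \<delta> J \<le> z $ 1 \<and> z $ 1 \<le> a" for J
      proof -
        \<comment> \<open>Finitely many images of the compact closure form a closed set; all
          remaining squares lie in the strip of width \<open>4 * \<delta> J\<close> to the left of
          \<open>x = a\<close>.\<close>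
        define F where "F = frame \<union> (\<Union>j<J. stage j)"
        let ?T = "(\<Union>i\<in>F. (\<lambda>z. r i *\<^sub>R z + b i) ` ?cK) \<union> {z. a - 4 * \<delta> J \<le> z $ 1 \<and> z $ 1 \<le> a}"
        have "compact ((\<lambda>z. r i *\<^sub>R z + b i) ` ?cK)" for i
          by (intro compact_continuous_image compact_cK continuous_intros)
        moreover have "finite F" using finite_frame finite_stage by (simp add: F_def)
        moreover have "closed {z :: real^2. a - 4 * \<delta> J \<le> z $ 1 \<and> z $ 1 \<le> a}"
          by (intro closed_Collect_conj closed_Collect_le continuous_intros)
        ultimately have "closed ?T" by (intro closed_Un closed_UN) (auto intro: compact_imp_closed)
        moreover have "K \<subseteq> ?T"
        proof
          fix x assume "x \<in> K"
          then obtain i w where i: "i \<in> I" "w \<in> K" "x = r i *\<^sub>R w + b i" by (rule K_cases)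
          show "x \<in> ?T"
          proof (cases "i \<in> F")
            case True
            then show ?thesis using i closure_subset by blast
          next
            case False
            then have nF: "i \<notin> frame" "\<And>j. j < J \<Longrightarrow> i \<notin> stage j" by (auto simp: F_def)
            obtain j where ij: "i \<in> stage j" using nF(1) i(1) unfolding I_eq by blast
            moreover have "J \<le> j" using nF(2)[of j] ij by (meson not_le)
            ultimately obtain k where j: "i = Col j k \<and> k < N j \<or> i = Con j" "J \<le> j"
              by (auto simp: stage_def)
            have "a - 4 * \<delta> J \<le> x $ 1 \<and> x $ 1 \<le> a"
              using map_square(1,2)[OF i(1), of w] zigzag_square_bounds(1,2)[OF j(1)] i K_square
                decseqD[OF decseq_\<delta> j(2)] \<delta>_pos[of j] by auto
            then show ?thesis by simp
          qed
        qed
        ultimately have "z \<in> ?T" using z closure_minimal by blast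
        moreover have "F \<subseteq> I" by (auto simp: F_def I_eq)
        ultimately show ?thesis using nW by blast
      qed
      note bd = this
      have "(\<lambda>J. a - 4 * \<delta> J) \<longlonglongrightarrow> a - 4 * 0" by (intro tendsto_intros \<delta>_tendsto_0)
      then have "a - 4 * 0 \<le> z $ 1" by (rule LIMSEQ_le_const2) (use bd in blast)
      then have "z = pt a (z $ 2)" using bd[of 0] by (intro pt_eqI) auto
      then have "z \<in> K" using right_column_K[of "z $ 2"] z cK by (auto simp: mem_unit_square)
      then obtain i w where "i \<in> I" "w \<in> K" "z = r i *\<^sub>R w + b i" by (rule K_cases)
      then show False using nW closure_subset[of K] by blast
    qed
    then obtain i w where iw: "i \<in> I" "w \<in> ?cK" "z = r i *\<^sub>R w + b i" by blast
    obtain m where "\<phi> m = (\<lambda>z. r i *\<^sub>R z + b i)" using iw(1) by (rule obtain_nat)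
    then show "z \<in> (\<Union>m. \<phi> m ` ?cK)" using iw by (intro UN_I[of m]) auto
  qed
qed

lemma compact_K: "compact K"
  using closed_K K_square compact_unit_square by (meson compact_Int_closed inf.absorb_iff2 compact_imp_bounded bounded_subset compact_eq_bounded_closed)

end

section \<open>Paths in the attractor\<close>

context zigzag
begin

sublocale W: homothety_invariant K I r b "1 / 4"
proof unfold_locales
  show "0 \<le> r i \<and> r i \<le> 1 / 4" for i using r_pos[of i] r_le[of i] by simp
qed (use compact_K zero_K map_K in auto)

abbreviation "ex \<equiv> pt 1 0"
abbreviation "ey \<equiv> pt 0 1"

definition stage_start :: "nat \<Rightarrow> real^2" where "stage_start j = pt (a - 4 * \<delta> j) (1 / 2)"

definition height :: "nat \<Rightarrow> real" where "height j = real (N j) * \<delta> j"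

definition limit_point :: "real^2" where "limit_point = pt a (1 / 2)"

text \<open>The height of column \<open>j + 1\<close> enters because the path of stage
  \<open>j\<close> ends by descending along it. Adding the two heights instead of taking the maximum
  is harmless, as both tend to \<open>0\<close> when \<open>d\<close> does.\<close>

definition stage_box :: "nat \<Rightarrow> (real^2) set" where
  "stage_box j = {z \<in> K. a - 4 * \<delta> j \<le> z $ 1 \<and> z $ 1 \<le> a \<and> 1 / 2 \<le> z $ 2 \<and> z $ 2 \<le> 1 / 2 + height j + height (Suc j)}"

lemma height_nonneg: "0 \<le> height j"
  using \<delta>_pos[of j] by (simp add: height_def)

lemma \<kappa>_less_height: "real (\<kappa> j) * \<delta> j + \<delta> j \<le> height j" "real (\<kappa> j) * \<delta> j \<le> height (Suc j)"
proof -
  show "real (\<kappa> j) * \<delta> j + \<delta> j \<le> height j" using Suc_k_\<delta>_le[OF \<kappa>_less_N(1)] by (simp add: height_def)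
  have "real (2 * \<kappa> j) * \<delta> (Suc j) + \<delta> (Suc j) \<le> height (Suc j)"
    using Suc_k_\<delta>_le[OF \<kappa>_less_N(2)] by (simp add: height_def)
  then show "real (\<kappa> j) * \<delta> j \<le> height (Suc j)" using \<delta>_Suc[of j] \<delta>_pos[of "Suc j"] by simp
qed

lemma stage_square_in_box:
  assumes "i = Col j k \<and> k < N j \<or> i = Con j" "z \<in> K"
  shows "r i *\<^sub>R z + b i \<in> stage_box j"
proof -
  have i: "i \<in> I" using assms(1) by auto
  show ?thesis
    using zigzag_square_bounds[OF assms(1)] map_square[OF i, of z] K_square assms(2) map_K[OF i assms(2)]
      \<delta>_pos[of j] height_nonneg[of "Suc j"] unfolding stage_box_def height_def by auto
qed

lemma column_in_box:
  assumes "0 \<le> u" "u \<le> height j"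
  shows "stage_start j + u *\<^sub>R ey \<in> stage_box j"
proof -
  have "stage_start j + u *\<^sub>R ey = pt (a - 4 * \<delta> j) (1 / 2 + u)"
    by (intro pt_eqI) (simp_all add: stage_start_def)
  then show ?thesis
    using column_K[of "1 / 2 + u" j] assms \<delta>_pos[of j] height_nonneg[of "Suc j"]
    by (simp add: stage_box_def height_def)
qed

lemma next_column_in_box:
  assumes "0 \<le> u" "u \<le> height (Suc j)"
  shows "stage_start (Suc j) + u *\<^sub>R ey \<in> stage_box j"
proof -
  have "stage_start (Suc j) + u *\<^sub>R ey = pt (a - 4 * \<delta> (Suc j)) (1 / 2 + u)"
    by (intro pt_eqI) (simp_all add: stage_start_def)
  then show ?thesis
    using column_K[of "1 / 2 + u" "Suc j"] assms \<delta>_pos[of j] \<delta>_pos[of "Suc j"] \<delta>_Suc[of j] height_nonneg[of j]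
    by (simp add: stage_box_def flip: height_def)
qed

lemma bottom_edge_in_box:
  assumes "i = Col j k \<and> k < N j \<or> i = Con j" "0 \<le> u" "u \<le> \<delta> j"
  shows "b i + u *\<^sub>R ex \<in> stage_box j"
proof -
  have i: "i \<in> I" and ri: "r i = \<delta> j" using assms(1) by auto
  have eq: "b i + u *\<^sub>R ex = pt (b i $ 1 + u) (b i $ 2)"
    by (intro pt_eqI) simp_all
  have "pt (b i $ 1 + u) (b i $ 2) \<in> K" using bottom_edge_K[OF i] assms(2,3) ri by simp
  then show ?thesis
    using zigzag_square_bounds[OF assms(1)] assms(2,3) ri \<delta>_pos[of j] height_nonneg[of "Suc j"]
    unfolding eq stage_box_def height_def by simp
qed

text \<open>The route climbs column \<open>j\<close> with a loop at each square, returns to the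
  height \<open>y\<close> of the connector, follows the bottom edges of
  \<open>Col j (\<kappa> j)\<close> and \<open>Con j\<close> to the left edge of column
  \<open>j + 1\<close>, and descends to its foot. Column \<open>j + 1\<close> reaches up to
  \<open>y\<close> because \<open>2 * \<kappa> j < N (Suc j)\<close>.\<close>

lemma weave_stage: "W.weave (stage_box j) (stage j) (stage_start j) (stage_start (Suc j))"
proof -
  define y where "y = real (\<kappa> j) * \<delta> j"
  have y: "0 \<le> y" "y \<le> height j" "y \<le> height (Suc j)"
    using \<kappa>_less_height[of j] \<delta>_pos[of j] by (auto simp: y_def)
  have "W.weave (stage_box j) (Col j ` {..<N j}) (stage_start j) (stage_start j + height j *\<^sub>R ey)"
    unfolding height_def
  proof (rule W.weave_row[where m="N j"])
    show "b (Col j k) = stage_start j + (real k * \<delta> j) *\<^sub>R ey" for k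
      by (rule vec_eq_iff[THEN iffD2]) (simp add: forall_2 stage_start_def)
  qed (use stage_square_in_box[of "Col j _" j] column_in_box[of _ j] \<delta>_pos[of j] in \<open>auto simp: height_def\<close>)
  moreover have "W.weave (stage_box j) {} (stage_start j + height j *\<^sub>R ey) (stage_start j + y *\<^sub>R ey)"
    by (rule W.weave_segment[of 0 "height j", OF column_in_box]) (use y height_nonneg in auto)
  moreover have "W.weave (stage_box j) {} (stage_start j + y *\<^sub>R ey) (b (Con j))"
  proof -
    have "W.weave (stage_box j) {} (b (Col j (\<kappa> j)) + 0 *\<^sub>R ex) (b (Col j (\<kappa> j)) + \<delta> j *\<^sub>R ex)"
      by (rule W.weave_segment[of 0 "\<delta> j", OF bottom_edge_in_box]) (use \<kappa>_less_N \<delta>_pos[of j] in auto)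
    moreover have "b (Col j (\<kappa> j)) + 0 *\<^sub>R ex = stage_start j + y *\<^sub>R ey" "b (Col j (\<kappa> j)) + \<delta> j *\<^sub>R ex = b (Con j)"
      by (simp_all add: vec_eq_iff forall_2 stage_start_def y_def)
    ultimately show ?thesis by simp
  qed
  moreover have "W.weave (stage_box j) {Con j} (b (Con j)) (b (Con j))"
    by (rule W.weave_loop) (use stage_square_in_box[of "Con j" j] in auto)
  moreover have "W.weave (stage_box j) {} (b (Con j)) (stage_start (Suc j) + y *\<^sub>R ey)"
  proof -
    have "W.weave (stage_box j) {} (b (Con j) + 0 *\<^sub>R ex) (b (Con j) + \<delta> j *\<^sub>R ex)"
      by (rule W.weave_segment[of 0 "\<delta> j", OF bottom_edge_in_box]) (use \<delta>_pos[of j] in auto)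
    moreover have "b (Con j) + \<delta> j *\<^sub>R ex = stage_start (Suc j) + y *\<^sub>R ey"
      using \<delta>_Suc[of j] by (simp add: vec_eq_iff forall_2 stage_start_def y_def)
    ultimately show ?thesis by simp
  qed
  moreover have "W.weave (stage_box j) {} (stage_start (Suc j) + y *\<^sub>R ey) (stage_start (Suc j) + 0 *\<^sub>R ey)"
    by (rule W.weave_segment[of 0 "height (Suc j)", OF next_column_in_box]) (use y height_nonneg in auto)
  ultimately have "W.weave (stage_box j)
     (Col j ` {..<N j} \<union> ({} \<union> ({} \<union> ({Con j} \<union> ({} \<union> {}))))) (stage_start j) (stage_start (Suc j) + 0 *\<^sub>R ey)"
    by (blast intro: W.weave_join)
  then show ?thesis by (simp add: stage_def)
qed

text \<open>The left arm is climbed and retraced, the base followed to its right end and back to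
  \<open>x = a\<close>, the right arm climbed and descended to height \<open>1 / 2\<close>. The zero
  summands keep consecutive end points syntactically equal.\<close>

lemma weave_frame: "W.weave K frame 0 limit_point"
proof -
  have nn: "real n * (1 / real n) = 1" using n by simp
  have "W.weave K (Grid 0 ` {..<n}) 0 (0 + (real n * (1 / real n)) *\<^sub>R ey)"
  proof (rule W.weave_row[where m=n])
    show "b (Grid 0 k) = 0 + (real k * (1 / real n)) *\<^sub>R ey" for k by (simp add: vec_eq_iff forall_2)
    show "0 + u *\<^sub>R ey \<in> K" if "0 \<le> u" "u \<le> real n * (1 / real n)" for u
      by (rule edges_K) (use that nn in \<open>auto simp: mem_unit_square\<close>)
    show "r (Grid 0 k) *\<^sub>R z + b (Grid 0 k) \<in> K" if "k < n" "z \<in> K" for k z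
      by (rule map_K) (use that in auto)
  qed (use n in auto)
  moreover have "W.weave K {} (0 + (real n * (1 / real n)) *\<^sub>R ey) (0 + 0 *\<^sub>R ey)"
    unfolding nn
  proof (rule W.weave_segment[of 0 1])
    show "0 + u *\<^sub>R ey \<in> K" if "0 \<le> u" "u \<le> 1" for u
      by (rule edges_K) (use that in \<open>auto simp: mem_unit_square\<close>)
  qed auto
  moreover have "W.weave K ((\<lambda>p. Grid p 0) ` {..<n}) (0 + 0 *\<^sub>R ey) (0 + 0 *\<^sub>R ey + (real n * (1 / real n)) *\<^sub>R ex)"
  proof (rule W.weave_row[where m=n])
    show "b (Grid k 0) = 0 + 0 *\<^sub>R ey + (real k * (1 / real n)) *\<^sub>R ex" for k by (simp add: vec_eq_iff forall_2)
    show "0 + 0 *\<^sub>R ey + u *\<^sub>R ex \<in> K" if "0 \<le> u" "u \<le> real n * (1 / real n)" for u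
      by (rule edges_K) (use that nn in \<open>auto simp: mem_unit_square\<close>)
    show "r (Grid k 0) *\<^sub>R z + b (Grid k 0) \<in> K" if "k < n" "z \<in> K" for k z
      by (rule map_K) (use that n in auto)
  qed (use n in auto)
  moreover have "W.weave K {} (0 + 0 *\<^sub>R ey + (real n * (1 / real n)) *\<^sub>R ex) (0 + 0 *\<^sub>R ey + a *\<^sub>R ex)"
    unfolding nn
  proof (rule W.weave_segment[of 0 1])
    show "0 + 0 *\<^sub>R ey + u *\<^sub>R ex \<in> K" if "0 \<le> u" "u \<le> 1" for u
      by (rule edges_K) (use that in \<open>auto simp: mem_unit_square\<close>)
  qed (use a in auto)
  moreover have right: "0 + 0 *\<^sub>R ey + a *\<^sub>R ex + u *\<^sub>R ey \<in> K" if "0 \<le> u" "u \<le> 1" for u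
  proof -
    have "0 + 0 *\<^sub>R ey + a *\<^sub>R ex + u *\<^sub>R ey = pt a u" by (intro pt_eqI) simp_all
    then show ?thesis using right_column_K that by simp
  qed
  moreover have "W.weave K (Grid (n - 1) ` {..<n}) (0 + 0 *\<^sub>R ey + a *\<^sub>R ex)
      (0 + 0 *\<^sub>R ey + a *\<^sub>R ex + (real n * (1 / real n)) *\<^sub>R ey)"
  proof (rule W.weave_row[where m=n])
    show "b (Grid (n - 1) k) = 0 + 0 *\<^sub>R ey + a *\<^sub>R ex + (real k * (1 / real n)) *\<^sub>R ey" for k
      by (simp add: vec_eq_iff forall_2 grid_last del: One_nat_def)
    show "0 + 0 *\<^sub>R ey + a *\<^sub>R ex + u *\<^sub>R ey \<in> K" if "0 \<le> u" "u \<le> real n * (1 / real n)" for u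
      using right that nn by simp
    show "r (Grid (n - 1) k) *\<^sub>R z + b (Grid (n - 1) k) \<in> K" if "k < n" "z \<in> K" for k z
      by (rule map_K) (use that n in auto)
  qed (use n in auto)
  moreover have "W.weave K {} (0 + 0 *\<^sub>R ey + a *\<^sub>R ex + (real n * (1 / real n)) *\<^sub>R ey)
      (0 + 0 *\<^sub>R ey + a *\<^sub>R ex + (1 / 2) *\<^sub>R ey)"
    unfolding nn by (rule W.weave_segment[of 0 1, OF right]) auto
  moreover have "0 + 0 *\<^sub>R ey + a *\<^sub>R ex + (1 / 2) *\<^sub>R ey = limit_point"
    by (simp add: vec_eq_iff forall_2 limit_point_def)
  ultimately have "W.weave K (Grid 0 ` {..<n} \<union> ({} \<union> ((\<lambda>p. Grid p 0) ` {..<n} \<union> ({} \<union> (Grid (n - 1) ` {..<n} \<union> {})))))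
      0 limit_point"
    by (metis W.weave_join)
  then show ?thesis by (rule W.weave_subset) (auto simp: frame_def)
qed

text \<open>All \<open>b i\<close> lie in the component of \<open>0\<close>; hence this closed
  component is invariant under the system and contains the attractor.\<close>

lemma connected_K: "connected K"
proof -
  have stage_conn: "connected_component K (stage_start 0) (stage_start j)" for j
  proof (induction j)
    case 0
    have "stage_start 0 \<in> K" using column_in_box[of 0 0] height_nonneg[of 0] by (simp add: stage_box_def)
    then show ?case by simp
  next
    case (Suc j)
    have "W.weave K (stage j) (stage_start j) (stage_start (Suc j))"
      by (rule W.weave_subset[OF weave_stage]) (auto simp: stage_box_def)
    then show ?case using W.weave_connected_component(1) Suc connected_component_trans by blast
  qed
  have stage_b: "connected_component K (stage_start 0) (b i)" if "i \<in> stage j" for i j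
  proof -
    have "W.weave K (stage j) (stage_start j) (stage_start (Suc j))"
      by (rule W.weave_subset[OF weave_stage]) (auto simp: stage_box_def)
    then show ?thesis using W.weave_connected_component(2)[OF _ that] stage_conn connected_component_trans by blast
  qed
  have "(\<lambda>j. (a - 4 * \<delta> j) *\<^sub>R ex + (1 / 2) *\<^sub>R ey) \<longlonglongrightarrow> (a - 4 * 0) *\<^sub>R ex + (1 / 2) *\<^sub>R ey"
    by (intro tendsto_intros \<delta>_tendsto_0)
  moreover have "(a - 4 * \<delta> j) *\<^sub>R ex + (1 / 2) *\<^sub>R ey = stage_start j" for j
    by (simp add: vec_eq_iff forall_2 stage_start_def)
  moreover have "(a - 4 * 0) *\<^sub>R ex + (1 / 2) *\<^sub>R ey = limit_point"
    by (simp add: vec_eq_iff forall_2 limit_point_def)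
  ultimately have "stage_start \<longlonglongrightarrow> limit_point" by simp
  \<comment> \<open>The chain and the U are linked here by closedness of components, which requires
    no path between them.\<close>
  then have "limit_point \<in> connected_component_set K (stage_start 0)"
    by (rule closed_sequentially[OF closed_connected_component[OF closed_K], rotated]) (use stage_conn in simp)
  then have lim: "connected_component K (stage_start 0) limit_point" by simp
  have "connected_component K 0 limit_point" using W.weave_connected_component(1)[OF weave_frame] .
  then have start: "connected_component K 0 (stage_start 0)"
    using lim connected_component_sym connected_component_trans by metis
  have b0: "connected_component K 0 (b i)" if i: "i \<in> I" for i
  proof (cases "i \<in> frame")
    case True
    then show ?thesis using W.weave_connected_component(2)[OF weave_frame] by blast
  next
    case False
    then show ?thesis using i stage_b start connected_component_trans unfolding I_eq by blast
  qed
  let ?C = "connected_component_set K 0"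
  have "K \<subseteq> ?C"
  proof (rule K_subset)
    show "closed ?C" by (rule closed_connected_component[OF closed_K])
    show "?C \<subseteq> unit_square" using connected_component_subset K_square by (rule subset_trans)
    have zero_C: "0 \<in> ?C" using zero_K by simp
    then show "?C \<noteq> {}" by blast
    fix i z assume i: "i \<in> I" and z: "z \<in> ?C"
    let ?D = "(\<lambda>z. r i *\<^sub>R z + b i) ` ?C"
    \<comment> \<open>The image of the component is connected and contains \<open>b i\<close>, the
      image of \<open>0\<close>, so it stays in the component.\<close>
    have "connected ?D" by (intro connected_continuous_image connected_connected_component continuous_intros)
    moreover have "?D \<subseteq> K" using map_K[OF i] connected_component_subset by blast
    moreover have "b i \<in> ?D" using zero_C by (intro image_eqI[of _ _ 0]) simp_all
    moreover have "r i *\<^sub>R z + b i \<in> ?D" using z by blast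
    ultimately have "connected_component K (b i) (r i *\<^sub>R z + b i)"
      unfolding connected_component_def by blast
    then show "r i *\<^sub>R z + b i \<in> ?C" using b0[OF i] connected_component_trans by blast
  qed
  then have "K = ?C" using connected_component_subset by blast
  then show ?thesis using connected_connected_component by metis
qed

text \<open>When the heights vanish, the stages shrink to \<open>limit_point\<close>, and one weave
  covers the U and the whole chain. The image of its fixed path is closed and invariant, hence all
  of the attractor.\<close>

lemma curve_image_K:
  assumes "d \<longlonglongrightarrow> 0"
  shows "curve_image K"
proof -
  have "height \<longlonglongrightarrow> 0"
  \<comment> \<open>Column \<open>0\<close> has no preceding connector, so the estimate is stated
    for the later columns.\<close>
  proof (rule LIMSEQ_imp_Suc, rule Lim_null_comparison)
    have "height (Suc j) \<le> d j + d (Suc j) + \<delta> (Suc j)" for j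
      using N_Suc_\<delta>[of j] \<kappa>_le[of j] \<kappa>_le[of "Suc j"] by (simp add: height_def)
    then show "\<forall>\<^sub>F j in sequentially. norm (height (Suc j)) \<le> d j + d (Suc j) + \<delta> (Suc j)"
      using height_nonneg by simp
    have "(\<lambda>j. d j + d (Suc j) + \<delta> (Suc j)) \<longlonglongrightarrow> 0 + 0 + 0"
      by (intro tendsto_add assms LIMSEQ_Suc[OF assms] LIMSEQ_Suc[OF \<delta>_tendsto_0])
    then show "(\<lambda>j. d j + d (Suc j) + \<delta> (Suc j)) \<longlonglongrightarrow> 0" by simp
  qed
  from this LIMSEQ_Suc[OF this]
  have "(\<lambda>j. 4 * \<delta> j + (height j + height (Suc j))) \<longlonglongrightarrow> 4 * 0 + (0 + 0)"
    by (intro tendsto_intros \<delta>_tendsto_0)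
  then have small: "(\<lambda>j. 4 * \<delta> j + (height j + height (Suc j))) \<longlonglongrightarrow> 0" by simp
  have box: "stage_box j \<subseteq> cball limit_point (4 * \<delta> j + (height j + height (Suc j)))" for j
  proof
    fix z assume z: "z \<in> stage_box j"
    have "norm (limit_point - z) \<le> \<bar>a - z $ 1\<bar> + \<bar>1 / 2 - z $ 2\<bar>"
      using norm_le_l1_cart[of "limit_point - z"] by (simp add: sum_2 limit_point_def)
    then show "z \<in> cball limit_point (4 * \<delta> j + (height j + height (Suc j)))"
      using z by (simp add: stage_box_def dist_norm abs_if split: if_splits)
  qed
  have "W.weave K (\<Union>j. stage j) (stage_start 0) limit_point"
  proof (rule W.weave_infinite[where R=stage_box and S=stage and q=stage_start, OF weave_stage])
    show "stage_box m \<subseteq> K" for m by (auto simp: stage_box_def)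
    show "limit_point \<in> K" using right_column_K[of "1 / 2"] by (simp add: limit_point_def)
    fix e :: real assume "0 < e"
    then obtain M where "\<forall>j\<ge>M. 4 * \<delta> j + (height j + height (Suc j)) < e"
      using order_tendstoD(2)[OF small] unfolding eventually_sequentially by metis
    then have "\<forall>m\<ge>M. stage_box m \<subseteq> cball limit_point e"
      using box by (meson less_imp_le subset_cball subset_trans)
    then show "\<exists>M. \<forall>m\<ge>M. stage_box m \<subseteq> cball limit_point e" by blast
  qed
  \<comment> \<open>The U is left at \<open>limit_point\<close>, so the chain is traversed backwards
    from there.\<close>
  then have "W.weave K (frame \<union> (\<Union>j. stage j)) 0 (stage_start 0)"
    using W.weave_join[OF weave_frame W.weave_reverse] by blast
  then have "W.weave K I 0 (stage_start 0)" by (simp only: I_eq)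
  then obtain g where g: "g \<in> W.based_paths"
    "\<And>i. i \<in> I \<Longrightarrow> (\<lambda>z. r i *\<^sub>R z + b i) ` path_image g \<subseteq> path_image g"
    by (rule W.weave_fixed_path) blast
  have gp: "path g" "path_image g \<subseteq> K" using g(1) by (auto simp: W.based_paths_def)
  have "K \<subseteq> path_image g"
    by (rule K_subset) (use gp g(2) K_square closed_path_image[OF gp(1)] in auto)
  then show ?thesis using gp unfolding curve_image_def by blast
qed

text \<open>On the attractor this is the distance to the line \<open>x = a\<close> for points of the zigzag, and \<open>0\<close> for
  points of the U.\<close>

definition depth :: "real^2 \<Rightarrow> real" where
  "depth z = max 0 (min (a - z $ 1) (min (z $ 1 - 1 / 4) (z $ 2 - 1 / 4)))"

lemma continuous_on_depth: "continuous_on A depth"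
  unfolding depth_def by (intro continuous_intros)

lemma depth_0: "depth 0 = 0"
  using a by (simp add: depth_def)

lemma depth_stage_start: "depth (stage_start 0) = 4 * \<delta> 0"
  using a \<delta>_le[of 0] \<delta>_pos[of 0] by (simp add: depth_def stage_start_def)

text \<open>Squares of the U have depth \<open>0\<close>, and those of stage \<open>j'\<close> have
  depths between \<open>2 * \<delta> j'\<close> and \<open>4 * \<delta> j'\<close>. The value
  \<open>5 / 2 * \<delta> j\<close> therefore selects stage \<open>j\<close>, and being below
  \<open>3 * \<delta> j\<close> it selects the connector.\<close>

lemma depth_level:
  assumes z: "z \<in> K" and depth: "depth z = 5 / 2 * \<delta> j"
  shows "1 / 2 + real (\<kappa> j) * \<delta> j \<le> z $ 2" "z $ 2 \<le> 1 / 2 + real (\<kappa> j) * \<delta> j + \<delta> j"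
proof -
  obtain i w where i: "i \<in> I" and w: "w \<in> K" "z = r i *\<^sub>R w + b i" using z by (rule K_cases)
  have w_square: "w \<in> unit_square" using w(1) K_square by blast
  note bounds = map_square(1-4)[OF i w_square, folded w(2)]
  have pos: "0 < depth z" using depth \<delta>_pos[of j] by simp
  obtain j' k where k: "i = Col j' k \<and> k < N j' \<or> i = Con j'"
    using i
  proof (cases rule: I_cases2)
    case (1 p q)
    then have "p = 0 \<or> q = 0 \<or> p = n - 1" using i by simp
    then have "z $ 1 \<le> 1 / 4 \<or> z $ 2 \<le> 1 / 4 \<or> a \<le> z $ 1"
    proof (elim disjE)
      assume "p = n - 1"
      then show ?thesis using bounds(1) 1 grid_last by (simp del: One_nat_def)
    qed (use bounds 1 a(3) in auto)
    then have "min (a - z $ 1) (min (z $ 1 - 1 / 4) (z $ 2 - 1 / 4)) \<le> 0"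
      by (simp only: min_le_iff_disj) linarith
    then have "depth z = 0" by (simp add: depth_def max_absorb1)
    then show ?thesis using pos by simp
  qed (use that in blast)
  note zz = zigzag_square_bounds[OF k]
  have "depth z = a - z $ 1"
    using bounds zz a \<delta>_le[of j'] \<delta>_pos[of j'] by (simp add: depth_def max_def min_def)
  then have z1: "z $ 1 = a - 5 / 2 * \<delta> j" using depth by linarith
  have "\<not> j' < j" using \<delta>_less[of j' j] z1 bounds zz \<delta>_pos[of j] by linarith
  moreover have "\<not> j < j'" using \<delta>_less[of j j'] z1 bounds zz \<delta>_pos[of j] by linarith
  ultimately have j': "j' = j" by simp
  have "i = Con j" using k z1 bounds(2) \<delta>_pos[of j] unfolding j' by auto
  then show "1 / 2 + real (\<kappa> j) * \<delta> j \<le> z $ 2" "z $ 2 \<le> 1 / 2 + real (\<kappa> j) * \<delta> j + \<delta> j"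
    using bounds(3,4) by simp_all
qed

text \<open>One of the two connectors is at the bottom, the other near the top. Rounding and the
  sides of the squares cost at most \<open>3 * \<delta> (Suc j)\<close>, which is at most
  \<open>3 / 8\<close> of \<open>d (Suc j)\<close>.\<close>

lemma oscillation:
  assumes "x \<in> K" "y \<in> K" "depth x = 5 / 2 * \<delta> j" "depth y = 5 / 2 * \<delta> (Suc j)"
  shows "d (Suc j) / 2 \<le> \<bar>x $ 2 - y $ 2\<bar>"
proof -
  note lx = depth_level[OF assms(1,3)] and ly = depth_level[OF assms(2,4)]
  have *: "\<delta> j = 2 * \<delta> (Suc j)" "8 * \<delta> (Suc j) \<le> d (Suc j)" "d (Suc j) \<le> d j" "0 < \<delta> (Suc j)"
    using \<delta>_Suc[of j] d_\<delta>[of "Suc j"] decseq_SucD[OF d(1), of j] \<delta>_pos[of "Suc j"] by auto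
  show ?thesis
  proof (cases "even j")
    case True
    have "\<kappa> (Suc j) = 0" using True by (simp add: \<kappa>_def)
    then show ?thesis using lx ly \<kappa>_ge[OF True] * by simp
  next
    case False
    have "\<kappa> j = 0" using False by (simp add: \<kappa>_def)
    then show ?thesis using lx ly \<kappa>_ge[of "Suc j"] False * by simp
  qed
qed

lemma decseq_levels: "decseq (\<lambda>j. 5 / 2 * \<delta> j)"
  using decseq_\<delta> by (simp add: decseq_def)

lemma stage_start_K: "stage_start 0 \<in> K"
  using column_in_box[of 0 0] height_nonneg[of 0] by (simp add: stage_box_def)

text \<open>The foot of column \<open>0\<close> has depth \<open>4 * \<delta> 0\<close>, above the
  first level, and the origin has depth \<open>0\<close>, below all levels.\<close>

lemma not_path_connected_K:
  assumes "0 < c" "\<And>j. c \<le> d j"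
  shows "\<not> path_connected K"
proof (rule not_path_connected_if_oscillating[where u=depth and v="\<lambda>z. z $ 2" and c="c / 2"
      and l="\<lambda>j. 5 / 2 * \<delta> j" and p="stage_start 0" and q=0])
  show "continuous_on K (\<lambda>z. z $ 2)" by (intro continuous_intros)
  show "c / 2 \<le> \<bar>x $ 2 - y $ 2\<bar>"
    if "x \<in> K" "y \<in> K" "depth x = 5 / 2 * \<delta> j" "depth y = 5 / 2 * \<delta> (Suc j)" for j x y
    using oscillation[OF that] assms(2)[of "Suc j"] by linarith
  show "5 / 2 * \<delta> 0 < depth (stage_start 0)" using \<delta>_pos[of 0] by (simp add: depth_stage_start)
  show "depth 0 \<le> 5 / 2 * \<delta> j" for j using \<delta>_pos[of j] by (simp add: depth_0)
qed (use assms(1) continuous_on_depth decseq_levels stage_start_K zero_K in auto)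

lemma not_hoelder_K:
  assumes "\<And>\<alpha> H. 1 \<le> \<alpha> \<Longrightarrow> 0 < H \<Longrightarrow> \<exists>J. 1 < real J * (d (Suc J) / 2 / H) powr \<alpha>"
  shows "\<not> hoelder_curve_image K"
proof (rule not_hoelder_if_oscillating[where u=depth and v="\<lambda>z. z $ 2" and c="\<lambda>j. d (Suc j) / 2"
      and l="\<lambda>j. 5 / 2 * \<delta> j" and p="stage_start 0" and q=0])
  show "\<bar>x $ 2 - y $ 2\<bar> \<le> dist x y" for x y :: "real^2"
    using dist_vec_nth_le[of x 2 y] by (simp add: dist_real_def)
  show "0 < d (Suc j) / 2" for j using d_\<delta>[of "Suc j"] \<delta>_pos[of "Suc j"] by simp
  show "decseq (\<lambda>j. d (Suc j) / 2)" using d(1) by (simp add: decseq_def)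
  show "5 / 2 * \<delta> 0 < depth (stage_start 0)" using \<delta>_pos[of 0] by (simp add: depth_stage_start)
  show "depth 0 \<le> 5 / 2 * \<delta> j" for j using \<delta>_pos[of j] by (simp add: depth_0)
  show "d (Suc j) / 2 \<le> \<bar>x $ 2 - y $ 2\<bar>"
    if "x \<in> K" "y \<in> K" "depth x = 5 / 2 * \<delta> j" "depth y = 5 / 2 * \<delta> (Suc j)" for j x y
    using oscillation[OF that] .
  show "\<exists>J. 1 < real J * (d (Suc J) / 2 / H) powr \<alpha>" if "1 \<le> \<alpha>" "0 < H" for \<alpha> H
    using assms[OF that] .
qed (fact continuous_on_depth decseq_levels stage_start_K zero_K)+

end

section \<open>Dimension and choice of parameters\<close>

lemma sum_Un_le:
  fixes f :: "'a \<Rightarrow> real"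
  assumes "finite A" "finite B" "\<And>x. 0 \<le> f x"
  shows "sum f (A \<union> B) \<le> sum f A + sum f B"
  using sum.union_inter[OF assms(1,2), of f] sum_nonneg[of "A \<inter> B" f] assms(3) by simp

context zigzag
begin

lemma sum_frame_le: "(\<Sum>i\<in>frame. r i powr t) \<le> 3 * real n * (1 / real n) powr t"
proof -
  have "card frame \<le> n + n + n"
  proof -
    have "card frame \<le> card (Grid 0 ` {..<n}) + card ((\<lambda>p. Grid p 0) ` {..<n}) + card (Grid (n - 1) ` {..<n})"
      unfolding frame_def by (meson card_Un_le order_trans add_right_mono)
    also have "\<dots> \<le> n + n + n"
      by (intro add_mono) (metis card_image_le card_lessThan finite_lessThan)+
    finally show ?thesis .
  qed
  then have c: "real (card frame) \<le> 3 * real n" by linarith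
  have "(\<Sum>i\<in>frame. r i powr t) = (\<Sum>i\<in>frame. (1 / real n) powr t)"
    by (intro sum.cong) (auto simp: frame_def)
  also have "\<dots> = real (card frame) * (1 / real n) powr t" by simp
  also have "\<dots> \<le> 3 * real n * (1 / real n) powr t" using c by (intro mult_right_mono) auto
  finally show ?thesis .
qed

lemma sum_stage_le: "(\<Sum>i\<in>stage j. r i powr (1 + s)) \<le> \<delta> j powr s"
proof -
  have card: "card (stage j) \<le> N j + 1"
  proof -
    have "card (stage j) \<le> Suc (card (Col j ` {..<N j}))" by (simp add: stage_def card_insert_if)
    also have "\<dots> \<le> N j + 1" using card_image_le[of "{..<N j}" "Col j"] by simp
    finally show ?thesis .
  qed
  have "(\<Sum>i\<in>stage j. r i powr (1 + s)) = (\<Sum>i\<in>stage j. \<delta> j powr (1 + s))"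
    by (intro sum.cong) (auto simp: stage_def)
  also have "\<dots> = real (card (stage j)) * (\<delta> j powr (1 + s))" by simp
  also have "\<dots> \<le> (real (N j) + 1) * (\<delta> j powr (1 + s))" using card by (intro mult_right_mono) auto
  also have "\<dots> = (real (N j) * \<delta> j + \<delta> j) * \<delta> j powr s"
    using \<delta>_pos[of j] by (simp add: powr_add algebra_simps)
  also have "\<dots> \<le> 1 * \<delta> j powr s"
    using N_\<delta>_le[of j] \<delta>_le[of j] by (intro mult_right_mono) auto
  finally show ?thesis by simp
qed

lemma sum_stages_le:
  "(\<Sum>i\<in>frame \<union> (\<Union>j<J. stage j). r i powr (1 + s))
     \<le> (\<Sum>i\<in>frame. r i powr (1 + s)) + (\<Sum>j<J. \<delta> j powr s)"
proof (induction J)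
  case (Suc J)
  let ?A = "frame \<union> (\<Union>j<J. stage j)"
  have "frame \<union> (\<Union>j<Suc J. stage j) = ?A \<union> stage J" by (auto simp: lessThan_Suc)
  then have "(\<Sum>i\<in>frame \<union> (\<Union>j<Suc J. stage j). r i powr (1 + s))
    \<le> (\<Sum>i\<in>?A. r i powr (1 + s)) + (\<Sum>i\<in>stage J. r i powr (1 + s))"
    using sum_Un_le[of ?A "stage J" "\<lambda>i. r i powr (1 + s)"] finite_frame finite_stage by simp
  then show ?case using Suc sum_stage_le[where j=J and s=s] by simp
qed simp

lemma finite_subset_stages:
  assumes "finite F" "F \<subseteq> I"
  obtains J where "F \<subseteq> frame \<union> (\<Union>j<J. stage j)"
proof -
  have "\<exists>J. F \<subseteq> frame \<union> (\<Union>j<J. stage j)"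
    using assms
  proof (induction F rule: finite_induct)
    case (insert i F)
    then obtain J where J: "F \<subseteq> frame \<union> (\<Union>j<J. stage j)" by auto
    obtain j where "i \<in> frame \<or> i \<in> stage j" using insert.prems unfolding I_eq by blast
    then have "insert i F \<subseteq> frame \<union> (\<Union>j<max J (Suc j). stage j)" using J by (auto simp: less_max_iff_disj)
    then show ?case by blast
  qed simp
  then show ?thesis using that by blast
qed

text \<open>Half of the budget \<open>1\<close> goes to the U, whose at most \<open>3 * n\<close>
  cells contribute at most \<open>3 / real n powr s\<close>; the other half goes to the chain,
  bounded by a geometric series with ratio \<open>(1 / 2) powr s\<close>.\<close>

lemma s_dim_\<phi>_le:
  assumes s: "0 < s" and n_large: "6 \<le> real n powr s"
    and \<delta>\<^sub>0_small: "\<delta>\<^sub>0 powr s \<le> (1 - (1 / 2) powr s) / 2"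
  shows "s_dim unit_square \<phi> \<le> ereal (1 + s)"
proof (rule s_dim_le)
  fix M
  define F where "F = from_nat_into I ` {..<M}"
  have "(\<Sum>m<M. Lip unit_square (\<phi> m) powr (1 + s)) = (\<Sum>i\<in>F. r i powr (1 + s))"
    unfolding F_def Lip_\<phi> by (subst sum.reindex) (auto simp: inj_on_def from_nat_eq)
  moreover obtain J where J: "F \<subseteq> frame \<union> (\<Union>j<J. stage j)"
    by (rule finite_subset_stages[of F]) (use from_nat_in_I in \<open>auto simp: F_def\<close>)
  have "(\<Sum>i\<in>F. r i powr (1 + s)) \<le> (\<Sum>i\<in>frame \<union> (\<Union>j<J. stage j). r i powr (1 + s))"
    using J finite_frame finite_stage by (intro sum_mono2) auto
  moreover have "\<dots> \<le> (\<Sum>i\<in>frame. r i powr (1 + s)) + (\<Sum>j<J. \<delta> j powr s)" by (rule sum_stages_le)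
  moreover have "(\<Sum>i\<in>frame. r i powr (1 + s)) \<le> 1 / 2"
  proof -
    have "(\<Sum>i\<in>frame. r i powr (1 + s)) \<le> 3 * real n * (1 / real n) powr (1 + s)" by (rule sum_frame_le)
    also have "\<dots> = 3 / real n powr s" using n by (simp add: powr_add powr_divide)
    also have "\<dots> \<le> 3 / 6" using n_large n by (intro divide_left_mono) auto
    finally show ?thesis by simp
  qed
  moreover have "(\<Sum>j<J. \<delta> j powr s) \<le> 1 / 2"
  proof -
    let ?q = "(1 / 2) powr s :: real"
    have q: "0 < ?q" "?q < 1" using powr_less_mono2[of s "1 / 2" 1] s by auto
    have "\<delta> j powr s = \<delta>\<^sub>0 powr s * ?q ^ j" for j
    proof -
      have "\<delta> j = \<delta>\<^sub>0 * (1 / 2) ^ j" by (simp add: \<delta>_def power_one_over)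
      then have "\<delta> j powr s = \<delta>\<^sub>0 powr s * ((1 / 2) ^ j) powr s" using \<delta>\<^sub>0(1) by (simp only: powr_mult)
      also have "((1 / 2 :: real) ^ j) powr s = ?q ^ j"
        by (simp add: powr_realpow[symmetric] powr_powr mult.commute)
      finally show ?thesis .
    qed
    then have "(\<Sum>j<J. \<delta> j powr s) = \<delta>\<^sub>0 powr s * (\<Sum>j<J. ?q ^ j)" by (simp add: sum_distrib_left)
    also have "(\<Sum>j<J. ?q ^ j) = (1 - ?q ^ J) / (1 - ?q)"
    proof -
      have "?q \<noteq> 1" using q(2) by (rule less_imp_neq)
      then show ?thesis unfolding sum_gp_strict by (rule if_not_P)
    qed
    also have "\<delta>\<^sub>0 powr s * ((1 - ?q ^ J) / (1 - ?q)) \<le> (1 - ?q) / 2 * (1 / (1 - ?q))"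
      using q \<delta>\<^sub>0_small by (intro mult_mono divide_right_mono) (auto simp: power_le_one)
    also have "\<dots> = 1 / 2" using q s by simp
    finally show ?thesis .
  qed
  ultimately show "(\<Sum>m<M. Lip unit_square (\<phi> m) powr (1 + s)) \<le> 1" by linarith
qed (use s in simp)

end

lemma zigzag_parameters:
  fixes s :: real
  assumes "0 < s"
  obtains n \<delta>\<^sub>0 where "4 \<le> n" "0 < \<delta>\<^sub>0" "\<delta>\<^sub>0 \<le> 1 / 128" "6 \<le> real n powr s" "\<delta>\<^sub>0 powr s \<le> (1 - (1 / 2) powr s) / 2"
proof -
  define n where "n = max 4 (nat \<lceil>6 powr (1 / s)\<rceil>)"
  have "6 powr (1 / s) \<le> real n" unfolding n_def by linarith
  then have "(6 powr (1 / s)) powr s \<le> real n powr s" using assms by (intro powr_mono2) auto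
  then have n: "6 \<le> real n powr s" using assms by (simp add: powr_powr)
  define c :: real where "c = (1 - (1 / 2) powr s) / 2"
  have c: "0 < c" using powr_less_mono2[of s "1 / 2" 1] assms by (simp add: c_def)
  have "min (1 / 128) (c powr (1 / s)) powr s \<le> (c powr (1 / s)) powr s"
    using assms c by (intro powr_mono2) auto
  also have "\<dots> = c" using assms c by (simp add: powr_powr)
  finally have "min (1 / 128) (c powr (1 / s)) powr s \<le> (1 - (1 / 2) powr s) / 2" by (simp only: c_def)
  moreover have "4 \<le> n" "0 < min (1 / 128) (c powr (1 / s))" "min (1 / 128) (c powr (1 / s)) \<le> 1 / 128"
    using c by (simp_all add: n_def)
  ultimately show ?thesis using that n by blast
qed

text \<open>No fixed power of a logarithm keeps pace with \<open>J\<close>.\<close>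

lemma log_growth:
  fixes \<alpha> H :: real
  assumes "1 \<le> \<alpha>" "0 < H"
  shows "\<exists>J. 1 < real J * (1 / (10 * (1 + ln (1 + real (Suc J)))) / 2 / H) powr \<alpha>"
proof -
  have "filterlim (\<lambda>J. real J * (1 / (10 * (1 + ln (1 + real (Suc J)))) / 2 / H) powr \<alpha>) at_top sequentially"
    using assms by real_asymp
  then have "eventually (\<lambda>J. 1 < real J * (1 / (10 * (1 + ln (1 + real (Suc J)))) / 2 / H) powr \<alpha>) sequentially"
    by (simp add: filterlim_at_top_dense)
  then show ?thesis by (auto simp: eventually_sequentially)
qed

lemma zigzag_constant:
  assumes "4 \<le> n" "0 < \<delta>\<^sub>0" "\<delta>\<^sub>0 \<le> 1 / 128"
  shows "zigzag n \<delta>\<^sub>0 (\<lambda>_. 1 / 10)"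
proof
  fix j
  have "\<delta>\<^sub>0 / 2 ^ j \<le> \<delta>\<^sub>0 / 1" using assms by (intro divide_left_mono) auto
  then show "8 * (\<delta>\<^sub>0 / 2 ^ j) \<le> 1 / 10" using assms by linarith
qed (use assms in \<open>auto simp: decseq_def\<close>)

text \<open>The lower bound on the heights follows from
  \<open>1 + ln (1 + real j) \<le> 1 + real j \<le> 2 ^ j\<close> and
  \<open>8 / 128 \<le> 1 / 10\<close>.\<close>

lemma zigzag_log:
  assumes "4 \<le> n" "0 < \<delta>\<^sub>0" "\<delta>\<^sub>0 \<le> 1 / 128"
  shows "zigzag n \<delta>\<^sub>0 (\<lambda>j. 1 / (10 * (1 + ln (1 + real j))))"
proof
  show "decseq (\<lambda>j. 1 / (10 * (1 + ln (1 + real j))))"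
  proof (intro decseq_SucI divide_left_mono mult_left_mono add_left_mono)
    show "0 < 10 * (1 + ln (1 + real (Suc j))) * (10 * (1 + ln (1 + real j)))" for j
      by (intro mult_pos_pos add_pos_nonneg ln_ge_zero) auto
  qed auto
  fix j
  have ln: "0 \<le> ln (1 + real j)" by (intro ln_ge_zero) auto
  then show "1 / (10 * (1 + ln (1 + real j))) \<le> 1 / 10" by (intro divide_left_mono) (simp_all add: add_pos_nonneg)
  have "1 + ln (1 + real j) \<le> 1 + real j" using ln_add_one_self_le_self[of "real j"] by simp
  also have "1 + real j = real (Suc j)" by simp
  also have "\<dots> \<le> real (2 ^ j)" using less_exp[of j] by (intro of_nat_mono Suc_leI)
  also have "real (2 ^ j) = 2 ^ j" by simp
  finally have "1 / (10 * 2 ^ j) \<le> 1 / (10 * (1 + ln (1 + real j)))"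
    using ln by (intro divide_left_mono mult_left_mono) (simp_all add: add_pos_nonneg)
  moreover have "8 * (\<delta>\<^sub>0 / 2 ^ j) \<le> 1 / 10 / 2 ^ j"
    using divide_right_mono[of "8 * \<delta>\<^sub>0" "1 / 10" "2 ^ j"] assms by simp
  ultimately show "8 * (\<delta>\<^sub>0 / 2 ^ j) \<le> 1 / (10 * (1 + ln (1 + real j)))" by simp
qed (use assms in auto)

theorem theorem1p1:
  shows "(\<forall>\<epsilon>::real. \<epsilon> > 0 \<longrightarrow>
      (\<exists>\<phi>. similarity_iifs_on_square \<phi> \<and> open_set_condition \<phi>
         \<and> s_dim unit_square \<phi> < ereal (1 + \<epsilon>)
         \<and> continuum (attractor unit_square \<phi>)
         \<and> \<not> path_connected (attractor unit_square \<phi>)))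
    \<and> (\<forall>\<epsilon>::real. \<epsilon> > 0 \<longrightarrow>
      (\<exists>\<phi>. similarity_iifs_on_square \<phi> \<and> open_set_condition \<phi>
         \<and> s_dim unit_square \<phi> < ereal (1 + \<epsilon>)
         \<and> curve_image (attractor unit_square \<phi>)
         \<and> \<not> hoelder_curve_image (attractor unit_square \<phi>)))"
proof (intro conjI allI impI)
  fix \<epsilon> :: real assume "\<epsilon> > 0"
  then obtain n \<delta>\<^sub>0 where p: "4 \<le> n" "0 < \<delta>\<^sub>0" "\<delta>\<^sub>0 \<le> 1 / 128"
    and dim: "6 \<le> real n powr (\<epsilon> / 2)" "\<delta>\<^sub>0 powr (\<epsilon> / 2) \<le> (1 - (1 / 2) powr (\<epsilon> / 2)) / 2"
    using zigzag_parameters[of "\<epsilon> / 2"] by auto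
  \<comment> \<open>The dimension estimate is not strict, so it is applied with
    \<open>\<epsilon> / 2\<close>. Both systems share \<open>n\<close> and
    \<open>\<delta>\<^sub>0\<close> and differ only in the heights.\<close>
  have half: "ereal (1 + \<epsilon> / 2) < ereal (1 + \<epsilon>)" "0 < \<epsilon> / 2" using \<open>\<epsilon> > 0\<close> by auto
  interpret const: zigzag n \<delta>\<^sub>0 "\<lambda>_. 1 / 10" by (rule zigzag_constant[OF p])
  have "s_dim unit_square const.\<phi> < ereal (1 + \<epsilon>)"
    using const.s_dim_\<phi>_le[OF half(2) dim] half(1) by (rule le_less_trans)
  then show "\<exists>\<phi>. similarity_iifs_on_square \<phi> \<and> open_set_condition \<phi>
         \<and> s_dim unit_square \<phi> < ereal (1 + \<epsilon>)
         \<and> continuum (attractor unit_square \<phi>)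
         \<and> \<not> path_connected (attractor unit_square \<phi>)"
    using const.similarity_iifs_on_square_\<phi> const.open_set_condition_\<phi> const.compact_K const.connected_K
      const.not_path_connected_K[of "1 / 10"] unfolding continuum_def by auto
  interpret slow: zigzag n \<delta>\<^sub>0 "\<lambda>j. 1 / (10 * (1 + ln (1 + real j)))" by (rule zigzag_log[OF p])
  have "(\<lambda>j. 1 / (10 * (1 + ln (1 + real j)))) \<longlonglongrightarrow> 0" by real_asymp
  then have "curve_image slow.K" by (rule slow.curve_image_K)
  moreover have "\<not> hoelder_curve_image slow.K" by (rule slow.not_hoelder_K[OF log_growth])
  moreover have "s_dim unit_square slow.\<phi> < ereal (1 + \<epsilon>)"
    using slow.s_dim_\<phi>_le[OF half(2) dim] half(1) by (rule le_less_trans)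
  ultimately show "\<exists>\<phi>. similarity_iifs_on_square \<phi> \<and> open_set_condition \<phi>
         \<and> s_dim unit_square \<phi> < ereal (1 + \<epsilon>)
         \<and> curve_image (attractor unit_square \<phi>)
         \<and> \<not> hoelder_curve_image (attractor unit_square \<phi>)"
    using slow.similarity_iifs_on_square_\<phi> slow.open_set_condition_\<phi> by auto
qed

end
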